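(* Let $A\in\mathbb{R}^{n\times n}$, $B\in\mathbb{R}^{n\times m}$, $B_1\in\mathbb{R}^{n\times p}$ be constant matrices with $(A,B)$ controllable, and let $\Sigma$ be a symmetric positive definite $n\times n$ matrix. Assume that there exists a symmetric $n\times n$ matrix $\Pi$ such that $A-BB'\Pi$ is a Hurwitz matrix and $$(A-BB'\Pi)\Sigma+\Sigma(A-BB'\Pi)'+B_1B_1'=0.$$ Then the control $u^*(t)=-B'\Pi x(t)$ solves the following problem: minimize the expected input power $J_{\rm power}(u)=\mathbb{E}\{u'u\}$ over all constant state-feedback laws $u(t)=-Kx(t)$, $K\in\mathbb{R}^{m\times n}$, such that $$dx(t)=(A-BK)x(t)\,dt+B_1\,dw(t)$$ admits $$\rho(x)=(2\pi)^{-n/2}\det(\Sigma)^{-1/2}\exp\left(-\tfrac12 x'\Sigma^{-1}x\right)$$ as invariant probability density.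
   Context: A prime denotes matrix transpose. A square matrix is Hurwitz if all its eigenvalues have strictly negative real part. $w$ is a standard $p$-dimensional Wiener process. The pair $(A,B)$ is controllable if $[B,\,AB,\ldots,A^{n-1}B]$ has rank $n$. The expectation in $J_{\rm power}$ is taken in the stationary regime, i.e. with $x$ distributed according to $\rho$, so that for $u=-Kx$ one has $J_{\rm power}(u)=\mathbb{E}\{x'K'Kx\}=\operatorname{trace}(K\Sigma K')$. *)

theory Defs
  imports "HOL-Probability.Probability"
begin

text \<open>The block matrix \<open>[B, A B, \<dots>, A\<^sup>n\<^sup>-\<^sup>1 B]\<close>, with \<open>n = CARD('n)\<close>. Its columns are indexed by
  \<open>'n \<times> 'm\<close>: the first component selects the block through the enumeration
  \<open>to_nat_on UNIV\<close>, a bijection between \<open>'n\<close> and \<open>{..<CARD('n)}\<close>. The function power is used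
  because \<open>*\<close> and \<open>^\<close> act componentwise on \<open>real ^ 'n ^ 'n\<close>.\<close>

definition controllability_matrix ::
    "real ^ 'n ^ 'n \<Rightarrow> real ^ 'm ^ 'n \<Rightarrow> real ^ ('n \<times> 'm) ^ 'n" where
  "controllability_matrix A B =
     (\<chi> i kj. (((\<lambda>X. A ** X) ^^ to_nat_on (UNIV :: 'n set) (fst kj)) B) $ i $ snd kj)"

definition controllable :: "real ^ 'n ^ 'n \<Rightarrow> real ^ 'm ^ 'n \<Rightarrow> bool" where
  "controllable A B \<longleftrightarrow> rank (controllability_matrix A B) = CARD('n)"

definition hurwitz :: "real ^ 'n ^ 'n \<Rightarrow> bool" where
  "hurwitz F \<longleftrightarrow>
     (\<forall>(c :: complex) (v :: complex ^ 'n).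
        v \<noteq> 0 \<and> map_matrix complex_of_real F *v v = c *s v \<longrightarrow> Re c < 0)"

definition sym_pos_def :: "real ^ 'n ^ 'n \<Rightarrow> bool" where
  "sym_pos_def S \<longleftrightarrow> transpose S = S \<and> (\<forall>x. x \<noteq> 0 \<longrightarrow> x \<bullet> (S *v x) > 0)"

definition gaussian_density :: "real ^ 'n ^ 'n \<Rightarrow> real ^ 'n \<Rightarrow> real" where
  "gaussian_density S x =
     (2 * pi) powr (- real CARD('n) / 2) * det S powr (- 1 / 2) *
     exp (- (1 / 2) * (x \<bullet> (matrix_inv S *v x)))"

definition wiener_process :: "'a measure \<Rightarrow> (real \<Rightarrow> 'a \<Rightarrow> real ^ 'p) \<Rightarrow> bool" where
  "wiener_process M w \<longleftrightarrow>
     prob_space M \<and>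
     (\<forall>t\<ge>0. w t \<in> borel_measurable M) \<and>
     (AE \<omega> in M. w 0 \<omega> = 0) \<and>
     (AE \<omega> in M. continuous_on {0..} (\<lambda>t. w t \<omega>)) \<and>
     (\<forall>s t. 0 \<le> s \<and> s < t \<longrightarrow>
        distributed M lborel (\<lambda>\<omega>. w t \<omega> - w s \<omega>)
          (\<lambda>z. ennreal (\<Prod>i\<in>UNIV. normal_density 0 (sqrt (t - s)) (z $ i)))) \<and>
     (\<forall>(\<tau> :: nat \<Rightarrow> real) N. 0 \<le> \<tau> 0 \<and> incseq \<tau> \<longrightarrow>
        prob_space.indep_vars M (\<lambda>_. borel)
          (\<lambda>k \<omega>. w (\<tau> (Suc k)) \<omega> - w (\<tau> k) \<omega>) {..<N})"

text \<open>Solutions on \<open>{0..}\<close> of \<open>dx = F x dt + G dw\<close>, \<open>x(0) = \<xi>\<close>, in the usual integral form. As \<open>G\<close> is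
  constant, the stochastic integral of \<open>G\<close> over \<open>{0..t}\<close> is \<open>G w(t)\<close>.\<close>

definition linear_sde_solution ::
    "'a measure \<Rightarrow> (real \<Rightarrow> 'a \<Rightarrow> real ^ 'p) \<Rightarrow> real ^ 'n ^ 'n \<Rightarrow> real ^ 'p ^ 'n \<Rightarrow>
     real ^ 'n \<Rightarrow> (real \<Rightarrow> 'a \<Rightarrow> real ^ 'n) \<Rightarrow> bool" where
  "linear_sde_solution M w F G \<xi> x \<longleftrightarrow>
     (\<forall>t\<ge>0. x t \<in> borel_measurable M) \<and>
     (AE \<omega> in M.
        continuous_on {0..} (\<lambda>t. x t \<omega>) \<and>
        (\<forall>t\<ge>0. x t \<omega> = \<xi> + integral {0..t} (\<lambda>s. F *v x s \<omega>) + G *v w t \<omega>))"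

text \<open>A probability density \<open>\<rho>\<close> is invariant for \<open>dx = F x dt + G dw\<close> if it is preserved by the
  transition kernels \<open>P\<^sub>t(\<xi>, E) = P(X \<xi> t \<in> E)\<close>, where \<open>X \<xi>\<close> is the solution started at \<open>\<xi>\<close>:
  \<open>\<integral> P\<^sub>t(\<xi>, E) \<rho>(\<xi>) d\<xi> = \<integral>\<^sub>E \<rho>(\<xi>) d\<xi>\<close>. Solutions are pathwise unique, so the kernels do not depend
  on the choice of \<open>X\<close>.\<close>

definition invariant_density ::
    "'a measure \<Rightarrow> (real \<Rightarrow> 'a \<Rightarrow> real ^ 'p) \<Rightarrow> real ^ 'n ^ 'n \<Rightarrow> real ^ 'p ^ 'n \<Rightarrow>
     (real ^ 'n \<Rightarrow> real) \<Rightarrow> bool" where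
  "invariant_density M w F G \<rho> \<longleftrightarrow>
     \<rho> \<in> borel_measurable borel \<and> (\<forall>x. 0 \<le> \<rho> x) \<and> prob_space (density lborel \<rho>) \<and>
     (\<exists>X. (\<forall>\<xi>. linear_sde_solution M w F G \<xi> (X \<xi>)) \<and>
       (\<forall>t\<ge>0. \<forall>E\<in>sets borel.
          (\<integral>\<^sup>+ \<xi>. emeasure (distr M borel (X \<xi> t)) E \<partial>density lborel \<rho>) =
          emeasure (density lborel \<rho>) E))"

text \<open>The expected input power \<open>E{u'u}\<close> of a feedback law \<open>u = u(x)\<close>, in the stationary regime in
  which the state \<open>x\<close> has density \<open>\<rho>\<close>.\<close>

definition J_power :: "(real ^ 'n \<Rightarrow> real) \<Rightarrow> (real ^ 'n \<Rightarrow> real ^ 'm) \<Rightarrow> real" where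
  "J_power \<rho> u = (LINT x|density lborel \<rho>. u x \<bullet> u x)"

definition feedback_law :: "real ^ 'n ^ 'm \<Rightarrow> real ^ 'n \<Rightarrow> real ^ 'm" where
  "feedback_law K = (\<lambda>x. - (K *v x))"

end

theory Submission
  imports Defs
begin

text \<open>
  For \<open>F = A - B K\<close> and \<open>G = B\<^sub>1\<close> the Gaussian density with covariance \<open>\<Sigma>\<close> is invariant if and only if
  \<open>F \<Sigma> + \<Sigma> F' + G G' = 0\<close>. Every solution of the equation is the pathwise limit of its Euler scheme with
  step \<open>h = t / n\<close>, so the law of \<open>x(t)\<close> is computed from the scheme. Started from the Gaussian law, the
  scheme has characteristic function \<open>exp (- q\<^sub>n(\<theta>) / 2)\<close> at \<open>\<theta>\<close>, where, with \<open>\<theta>\<^sub>j = (1 + h F')\<^sup>j \<theta>\<close>,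
  a telescoping sum gives
  \<open>q\<^sub>n(\<theta>) = \<theta>'\<Sigma>\<theta> + h \<Sum>\<^sub>j \<theta>\<^sub>j'(F \<Sigma> + \<Sigma> F' + G G') \<theta>\<^sub>j + O(h)\<close>. Under the Lyapunov equation the limit
  is \<open>\<theta>'\<Sigma>\<theta>\<close>; conversely, the middle term is \<open>t \<theta>'(F \<Sigma> + \<Sigma> F' + G G') \<theta> + O(t\<^sup>2)\<close> and must vanish for all \<open>t\<close>.

  The cost of \<open>K\<close> is \<open>trace (K \<Sigma> K')\<close>. Put \<open>D = K - B'\<Pi>\<close>. Subtracting the two Lyapunov equations gives
  \<open>B D \<Sigma> + \<Sigma> D' B' = 0\<close>, and tracing this against the symmetric matrix \<open>\<Pi>\<close> shows that the cross term
  \<open>trace (D \<Sigma> \<Pi> B)\<close> vanishes. Hence the cost exceeds that of \<open>B'\<Pi>\<close> by \<open>trace (D \<Sigma> D') \<ge> 0\<close>.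
\<close>

subsection \<open>The Euler scheme\<close>

text \<open>The argument \<open>d\<close> carries the noise increment of each step. With
  \<open>d = (\<lambda>_. 0)\<close> the scheme iterates the linear map \<open>1 + h F\<close>, so
  the same function also serves for the adjoint sequence built from
  \<open>transpose F\<close>.\<close>

primrec euler ::
    "real ^ 'n ^ 'n \<Rightarrow> real \<Rightarrow> real ^ 'n \<Rightarrow> (nat \<Rightarrow> real ^ 'n) \<Rightarrow> nat \<Rightarrow> real ^ 'n" where
  "euler F h \<xi> d 0 = \<xi>"
| "euler F h \<xi> d (Suc k) = euler F h \<xi> d k + h *\<^sub>R (F *v euler F h \<xi> d k) + d k"

lemma norm_matrix_bound:
  fixes F :: "real ^ 'n ^ 'm"
  obtains c where "0 < c" "\<And>x. norm (F *v x) \<le> c * norm x"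
  using bounded_linear.pos_bounded[OF matrix_vector_mul_bounded_linear[of F]]
  by (metis mult.commute)

lemma measurable_matrix_mult [measurable (raw)]:
  fixes A :: "real ^ 'n ^ 'm"
  shows "g \<in> borel_measurable M \<Longrightarrow> (\<lambda>x. A *v g x) \<in> borel_measurable M"
  by (rule borel_measurable_continuous_on[OF linear_continuous_on[OF matrix_vector_mul_bounded_linear]])

text \<open>Without noise a single linear map is iterated, so a step can be split off at the start
  as well as at the end. The backward propagation in \<open>inner_euler\<close> splits it off at the
  start.\<close>

lemma euler_zero_shift:
  "euler F h (\<theta> + h *\<^sub>R (F *v \<theta>)) (\<lambda>_. 0) j = euler F h \<theta> (\<lambda>_. 0) (Suc j)"
  by (induction j) auto

lemma inner_transpose_mult: "(transpose F *v x) \<bullet> y = x \<bullet> (F *v (y :: real ^ 'n))"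
  for F :: "real ^ 'n ^ 'm"
  by (simp add: dot_lmul_matrix flip: vector_transpose_matrix)

text \<open>The functional \<open>\<theta>\<close> is propagated backwards by the Euler scheme of the transposed matrix, which is
  the sequence \<open>\<theta>\<^sub>j\<close> above.\<close>

lemma inner_euler:
  "\<theta> \<bullet> euler F h \<xi> d n =
     euler (transpose F) h \<theta> (\<lambda>_. 0) n \<bullet> \<xi> +
     (\<Sum>k<n. euler (transpose F) h \<theta> (\<lambda>_. 0) (n - 1 - k) \<bullet> d k)"
proof (induction n arbitrary: \<theta>)
  case 0
  show ?case by simp
next
  case (Suc n)
  \<comment> \<open>Transposition moves the last step of the scheme onto the functional; the
    induction hypothesis is then used for this new functional, hence the generalisation over
    \<theta>.\<close>
  let ?\<theta> = "\<theta> + h *\<^sub>R (transpose F *v \<theta>)"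
  have "\<theta> \<bullet> euler F h \<xi> d (Suc n) = ?\<theta> \<bullet> euler F h \<xi> d n + \<theta> \<bullet> d n"
    by (simp add: inner_add_left inner_add_right dot_lmul_matrix)
  also have "\<dots> = euler (transpose F) h \<theta> (\<lambda>_. 0) (Suc n) \<bullet> \<xi> +
     (\<Sum>k<n. euler (transpose F) h \<theta> (\<lambda>_. 0) (Suc (n - 1 - k)) \<bullet> d k) + \<theta> \<bullet> d n"
    unfolding Suc.IH euler_zero_shift ..
  also have "(\<Sum>k<n. euler (transpose F) h \<theta> (\<lambda>_. 0) (Suc (n - 1 - k)) \<bullet> d k)
      = (\<Sum>k<n. euler (transpose F) h \<theta> (\<lambda>_. 0) (n - k) \<bullet> d k)"
    by (intro sum.cong refl) (simp add: Suc_diff_Suc)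
  finally show ?case by simp
qed

text \<open>One step from x to x + h y with y = F' x changes the form of \<open>S\<close> by exactly
  h (2 y'Sx) + h^2 y'Sy. Since 2 y'Sx = x'(F S + S F')x, adding the noise term |G'x|^2 completes the
  Lyapunov operator. The identity is exact for every h.\<close>

lemma euler_quadratic_telescope:
  fixes F S :: "real ^ 'n ^ 'n" and G :: "real ^ 'p ^ 'n" and h :: real and \<theta> :: "real ^ 'n"
  assumes "transpose S = S"
  defines "e \<equiv> euler (transpose F) h \<theta> (\<lambda>_. 0)"
  shows "e n \<bullet> (S *v e n) + h * (\<Sum>j<n. (norm (transpose G *v e j))\<^sup>2) =
     \<theta> \<bullet> (S *v \<theta>)
     + h * (\<Sum>j<n. e j \<bullet> ((F ** S + S ** transpose F + G ** transpose G) *v e j))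
     + h\<^sup>2 * (\<Sum>j<n. (transpose F *v e j) \<bullet> (S *v (transpose F *v e j)))"
proof (induction n)
  case 0
  show ?case by (simp add: e_def)
next
  case (Suc n)
  let ?x = "e n" and ?y = "transpose F *v e n"
  have e: "e (Suc n) = ?x + h *\<^sub>R ?y"
    by (simp add: e_def)
  have sym: "?x \<bullet> (S *v ?y) = ?y \<bullet> (S *v ?x)"
    using assms(1) by (metis inner_commute inner_transpose_mult)
  have FS: "?x \<bullet> ((F ** S) *v ?x) = ?y \<bullet> (S *v ?x)"
    by (simp add: dot_lmul_matrix flip: matrix_vector_mul_assoc)
  have SF: "?x \<bullet> ((S ** transpose F) *v ?x) = ?x \<bullet> (S *v ?y)"
    by (simp flip: matrix_vector_mul_assoc)
  have GG: "?x \<bullet> ((G ** transpose G) *v ?x) = (norm (transpose G *v ?x))\<^sup>2"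
    by (simp add: power2_norm_eq_inner dot_lmul_matrix flip: matrix_vector_mul_assoc)
  have step: "e (Suc n) \<bullet> (S *v e (Suc n)) =
      ?x \<bullet> (S *v ?x) + h * (2 * (?y \<bullet> (S *v ?x))) + h\<^sup>2 * (?y \<bullet> (S *v ?y))"
    unfolding e matrix_vector_right_distrib matrix_vector_mult_scaleR inner_add_left inner_add_right
      inner_scaleR_left inner_scaleR_right sym
    by algebra
  have L: "?x \<bullet> ((F ** S + S ** transpose F + G ** transpose G) *v ?x) =
      2 * (?y \<bullet> (S *v ?x)) + (norm (transpose G *v ?x))\<^sup>2"
    unfolding matrix_vector_mult_add_rdistrib inner_add_right FS SF GG sym by simp
  show ?case
    using Suc.IH unfolding sum.lessThan_Suc step L by algebra
qed

text \<open>Discrete Gronwall estimate from 1 + h c \<le> exp (h c). The bound depends only on the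
  elapsed time j h, so it is uniform in the number of steps.\<close>

lemma norm_euler_zero_le:
  assumes c: "\<And>x. norm (F *v x) \<le> c * norm x" "0 \<le> c" and h: "0 \<le> h"
  shows "norm (euler F h \<theta> (\<lambda>_. 0) j) \<le> exp (real j * h * c) * norm \<theta>"
proof (induction j)
  case 0
  show ?case by simp
next
  case (Suc j)
  let ?x = "euler F h \<theta> (\<lambda>_. 0) j"
  have "norm (euler F h \<theta> (\<lambda>_. 0) (Suc j)) \<le> norm ?x + h * norm (F *v ?x)"
    using h by (simp add: norm_triangle_le)
  also have "\<dots> \<le> (1 + h * c) * norm ?x"
    using mult_left_mono[OF c(1)[of ?x] h] by (simp add: algebra_simps)
  also have "\<dots> \<le> exp (h * c) * norm ?x"
    by (intro mult_right_mono exp_ge_add_one_self) auto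
  also have "\<dots> \<le> exp (h * c) * (exp (real j * h * c) * norm \<theta>)"
    by (intro mult_left_mono Suc.IH) auto
  also have "\<dots> = exp (real (Suc j) * h * c) * norm \<theta>"
    by (simp add: exp_add[symmetric] algebra_simps)
  finally show ?case .
qed

text \<open>Each step moves the iterate by at most h c times its norm, and the exponential bound at
  the final index n dominates all these norms. The result is linear in the elapsed time j h.\<close>

lemma norm_euler_zero_diff_le:
  assumes c: "\<And>x. norm (F *v x) \<le> c * norm x" "0 \<le> c" and h: "0 \<le> h" and "j \<le> n"
  shows "norm (euler F h \<theta> (\<lambda>_. 0) j - \<theta>) \<le> real j * h * c * exp (real n * h * c) * norm \<theta>"
  using \<open>j \<le> n\<close>
proof (induction j)
  case 0
  show ?case by simp
next
  case (Suc j)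
  let ?x = "euler F h \<theta> (\<lambda>_. 0) j"
  have "norm ?x \<le> exp (real j * h * c) * norm \<theta>"
    by (rule norm_euler_zero_le[OF c h])
  also have "\<dots> \<le> exp (real n * h * c) * norm \<theta>"
    using Suc.prems h c(2) by (intro mult_right_mono) (auto intro!: mult_right_mono)
  finally have x: "norm ?x \<le> exp (real n * h * c) * norm \<theta>" .
  have "norm (euler F h \<theta> (\<lambda>_. 0) (Suc j) - \<theta>) \<le> norm (?x - \<theta>) + h * norm (F *v ?x)"
    using h norm_triangle_ineq[of "?x - \<theta>" "h *\<^sub>R (F *v ?x)"] by (simp add: algebra_simps)
  also have "\<dots> \<le> norm (?x - \<theta>) + h * (c * (exp (real n * h * c) * norm \<theta>))"
    using order_trans[OF c(1)[of ?x] mult_left_mono[OF x c(2)]] h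
    by (intro add_left_mono mult_left_mono) auto
  also have "\<dots> \<le> real j * h * c * exp (real n * h * c) * norm \<theta>
      + h * (c * (exp (real n * h * c) * norm \<theta>))"
    using Suc by (intro add_right_mono) auto
  finally show ?case by (simp add: algebra_simps)
qed

text \<open>The argument concerns a single path: the increments of \<open>g\<close> enter the scheme
  and the equation identically and cancel. The only local error comes from freezing x at the left
  end of each interval, and uniform continuity of x makes it small.\<close>

lemma euler_converges:
  fixes x g :: "real \<Rightarrow> real ^ 'n"
  assumes t: "0 \<le> t"
    and x: "continuous_on {0..t} x"
    and eq: "\<And>s. 0 \<le> s \<Longrightarrow> s \<le> t \<Longrightarrow> x s = \<xi> + integral {0..s} (\<lambda>r. F *v x r) + g s"
    and g0: "g 0 = 0"
  shows "(\<lambda>n. euler F (t / real n) \<xi>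
           (\<lambda>k. g (real (Suc k) * (t / real n)) - g (real k * (t / real n))) n) \<longlonglongrightarrow> x t"
proof -
  obtain c where c: "0 < c" "\<And>x. norm (F *v x) \<le> c * norm x"
    by (rule norm_matrix_bound[of F]) blast
  define C where "C = t * c * exp (t * c)"
  have C: "0 \<le> C" using t c(1) by (simp add: C_def)
  have contF: "continuous_on {a..b} (\<lambda>r. F *v x r)" if "0 \<le> a" "b \<le> t" for a b
    by (rule linear_continuous_on_compose[OF continuous_on_subset[OF x] matrix_vector_mul_linear])
      (use that in auto)
  have step: "norm (euler F (t / real n) \<xi>
           (\<lambda>k. g (real (Suc k) * (t / real n)) - g (real k * (t / real n))) n - x t) \<le> C * \<epsilon>"
    if n: "0 < n" and \<epsilon>: "0 < \<epsilon>"
      and osc: "\<And>r s. \<lbrakk>r \<in> {0..t}; s \<in> {0..t}; \<bar>r - s\<bar> \<le> t / real n\<rbrakk> \<Longrightarrow> norm (x r - x s) \<le> \<epsilon>"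
    for n \<epsilon>
  proof -
    define h where "h = t / real n"
    have h: "0 \<le> h" "real n * h = t" using n t by (auto simp: h_def)
    define y where "y = euler F h \<xi> (\<lambda>k. g (real (Suc k) * h) - g (real k * h))"
    have kh: "real k * h \<le> t" if "k \<le> n" for k
      using that h by (metis mult_right_mono of_nat_le_iff)
    \<comment> \<open>Each of the k steps contributes a local error h c \<epsilon>, and later steps
      amplify it at most by exp (k h c).\<close>
    have "norm (y k - x (real k * h)) \<le> real k * (h * c * \<epsilon>) * exp (real k * h * c)" if "k \<le> n" for k
      using that
    proof (induction k)
      case 0
      have "x 0 = \<xi>" using eq[of 0] t g0 by simp
      then show ?case by (simp add: y_def)
    next
      case (Suc k)
      let ?a = "real k * h" and ?b = "real (Suc k) * h"
      have ab: "0 \<le> ?a" "?a \<le> ?b" "?b \<le> t"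
        using h kh[OF Suc.prems] by (auto intro: mult_right_mono)
      have int: "integral {?a..?b} (\<lambda>r. F *v x r) = x ?b - x ?a - (g ?b - g ?a)"
      proof -
        have "integral {0..?a} (\<lambda>r. F *v x r) + integral {?a..?b} (\<lambda>r. F *v x r)
            = integral {0..?b} (\<lambda>r. F *v x r)"
          using ab by (intro Henstock_Kurzweil_Integration.integral_combine
              integrable_continuous_interval contF) auto
        then show ?thesis using eq[of ?a] eq[of ?b] ab by (simp add: algebra_simps)
      qed
      have err: "norm (integral {?a..?b} (\<lambda>r. F *v x r - F *v x ?a)) \<le> c * \<epsilon> * (?b - ?a)"
      proof (rule integral_bound)
        show "norm (F *v x r - F *v x ?a) \<le> c * \<epsilon>" if "r \<in> {?a..?b}" for r
        proof -
          have "norm (x r - x ?a) \<le> \<epsilon>"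
            using that ab order_trans[OF ab(1), of r]
            by (intro osc) (auto simp: h_def[symmetric] algebra_simps)
          then have "c * norm (x r - x ?a) \<le> c * \<epsilon>" using c(1) by simp
          then show ?thesis using c(2)[of "x r - x ?a"]
            by (simp add: matrix_vector_mult_diff_distrib)
        qed
      qed (use ab in \<open>auto intro!: continuous_on_diff contF\<close>)
      have int2: "integral {?a..?b} (\<lambda>r. F *v x r - F *v x ?a)
          = integral {?a..?b} (\<lambda>r. F *v x r) - h *\<^sub>R (F *v x ?a)"
        using ab by (subst Henstock_Kurzweil_Integration.integral_diff)
          (auto intro!: integrable_continuous_interval contF simp: algebra_simps)
      \<comment> \<open>The increment of \<open>g\<close> has cancelled: the old error is propagated
        by 1 + h F and the freezing error is subtracted.\<close>
      have "y (Suc k) - x ?b = (y k - x ?a) + h *\<^sub>R (F *v (y k - x ?a))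
          - integral {?a..?b} (\<lambda>r. F *v x r - F *v x ?a)"
        unfolding int2 int by (simp add: y_def matrix_vector_mult_diff_distrib algebra_simps)
      then have "norm (y (Suc k) - x ?b) \<le> norm (y k - x ?a) + h * norm (F *v (y k - x ?a))
          + norm (integral {?a..?b} (\<lambda>r. F *v x r - F *v x ?a))"
        using h(1) by (simp only:)
          (intro order_trans[OF norm_triangle_ineq4] add_right_mono
            order_trans[OF norm_triangle_ineq], simp)
      also have "\<dots> \<le> norm (y k - x ?a) + h * (c * norm (y k - x ?a)) + c * \<epsilon> * (?b - ?a)"
        using h(1) by (intro add_mono err mult_left_mono c(2) order_refl)
      also have "\<dots> = (1 + h * c) * norm (y k - x ?a) + h * c * \<epsilon>"
        by (simp add: algebra_simps)
      also have "\<dots> \<le> exp (h * c) * (real k * (h * c * \<epsilon>) * exp (real k * h * c))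
          + exp (h * c) * exp (real k * h * c) * (h * c * \<epsilon>)"
      proof (rule add_mono[OF mult_mono])
        show "norm (y k - x ?a) \<le> real k * (h * c * \<epsilon>) * exp (real k * h * c)"
          using Suc by simp
        have "1 \<le> exp (h * c + real k * h * c)" using h c by simp
        then have "1 * (h * c * \<epsilon>) \<le> exp (h * c + real k * h * c) * (h * c * \<epsilon>)"
          using h c \<epsilon> by (intro mult_right_mono) auto
        then show "h * c * \<epsilon> \<le> exp (h * c) * exp (real k * h * c) * (h * c * \<epsilon>)"
          by (simp add: exp_add)
      qed (use h c \<epsilon> in \<open>auto intro: exp_ge_add_one_self\<close>)
      also have "\<dots> = real (Suc k) * (h * c * \<epsilon>) * exp (real (Suc k) * h * c)"
        by (simp add: exp_add algebra_simps)
      finally show ?case .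
    qed
    from this[OF order_refl] have "norm (y n - x t) \<le> real n * (h * c * \<epsilon>) * exp (t * c)"
      unfolding h(2) .
    also have "real n * (h * c * \<epsilon>) = t * c * \<epsilon>"
      unfolding h(2)[symmetric] by simp
    finally show ?thesis by (simp add: C_def y_def h_def mult_ac)
  qed
  have unif: "uniformly_continuous_on {0..t} x"
    using x by (intro compact_uniformly_continuous) auto
  show ?thesis
  proof (rule LIMSEQ_I)
    fix r :: real assume r: "0 < r"
    \<comment> \<open>The summand 1 keeps the denominator positive when C = 0, which happens for t =
      0.\<close>
    define \<epsilon> where "\<epsilon> = r / (2 * (C + 1))"
    have \<epsilon>: "0 < \<epsilon>" using r C by (simp add: \<epsilon>_def)
    have "C * \<epsilon> \<le> (C + 1) * \<epsilon>" using \<epsilon> by simp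
    also have "(C + 1) * \<epsilon> = r / 2" using C by (simp add: \<epsilon>_def field_simps)
    finally have C\<epsilon>: "C * \<epsilon> < r" using r by simp
    obtain \<delta> where \<delta>: "0 < \<delta>"
      "\<And>a b. \<lbrakk>a \<in> {0..t}; b \<in> {0..t}; dist b a < \<delta>\<rbrakk> \<Longrightarrow> dist (x b) (x a) < \<epsilon>"
      using unif \<epsilon> unfolding uniformly_continuous_on_def by metis
    \<comment> \<open>From \<open>Suc N\<close> on, the mesh t / n is below \<delta> and n is
      positive, as \<open>step\<close> requires.\<close>
    obtain N where N: "t / \<delta> < real N" using reals_Archimedean2 by blast
    have "norm (euler F (t / real n) \<xi>
           (\<lambda>k. g (real (Suc k) * (t / real n)) - g (real k * (t / real n))) n - x t) < r"
      if "n \<ge> Suc N" for n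
    proof -
      have n: "0 < n" "real N \<le> real n" using that by auto
      have "t / \<delta> < real n" using N n(2) by linarith
      then have "t / real n < \<delta>"
        using n(1) \<delta>(1) by (simp add: field_simps)
      then have "norm (x a - x b) \<le> \<epsilon>"
        if "a \<in> {0..t}" "b \<in> {0..t}" "\<bar>a - b\<bar> \<le> t / real n" for a b
        using \<delta>(2)[of b a] that by (auto simp: dist_norm)
      from step[OF n(1) \<epsilon> this] C\<epsilon> show ?thesis by simp
    qed
    then show "\<exists>no. \<forall>n\<ge>no. norm (euler F (t / real n) \<xi>
           (\<lambda>k. g (real (Suc k) * (t / real n)) - g (real k * (t / real n))) n - x t) < r"
      by blast
  qed
qed

subsection \<open>Linear integral equations\<close>

text \<open>These are the terms of the Neumann series; its partial sums are the Picard
  iterates.\<close>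

primrec picard :: "real ^ 'n ^ 'n \<Rightarrow> (real \<Rightarrow> real ^ 'n) \<Rightarrow> nat \<Rightarrow> real \<Rightarrow> real ^ 'n" where
  "picard F a 0 = a"
| "picard F a (Suc k) = (\<lambda>t. integral {0..t} (\<lambda>s. F *v picard F a k s))"

lemma continuous_on_matrix_mult:
  "continuous_on X x \<Longrightarrow> continuous_on X (\<lambda>s. F *v x s)"
  for F :: "real ^ 'n ^ 'm" and x :: "'a::euclidean_space \<Rightarrow> real ^ 'n"
  by (rule linear_continuous_on_compose[OF _ matrix_vector_mul_linear])

lemma continuous_on_nonneg_reals:
  fixes f :: "real \<Rightarrow> 'b::topological_space"
  assumes "\<And>T. continuous_on {0..T} f"
  shows "continuous_on {0..} f"
  unfolding continuous_on_def
proof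
  fix t :: real assume "t \<in> {0..}"
  then have "(f \<longlongrightarrow> f t) (at t within {0..t + 1})"
    using assms[of "t + 1"] by (auto simp: continuous_on_def)
  moreover have "at t within {0..t + 1} = at t within {0..}"
    by (rule at_within_nhd[of t "{..<t + 1}"]) auto
  ultimately show "(f \<longlongrightarrow> f t) (at t within {0..})" by simp
qed

lemma continuous_on_picard:
  assumes "continuous_on {0..} a"
  shows "continuous_on {0..} (picard F a k)"
proof (induction k)
  case 0
  then show ?case using assms by simp
next
  case (Suc k)
  show ?case unfolding picard.simps
    by (intro continuous_on_nonneg_reals indefinite_integral_continuous_1 integrable_continuous_interval
        continuous_on_matrix_mult continuous_on_subset[OF Suc.IH]) auto
qed

text \<open>The k-th term of the Neumann series is at most C (c T)^k / k! on {0..T}, by integrating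
  the bound of the previous term. The series therefore converges uniformly on compact intervals,
  which preserves continuity and permits integration term by term.\<close>

lemma linear_integral_equation_solvable:
  fixes F :: "real ^ 'n ^ 'n" and a :: "real \<Rightarrow> real ^ 'n"
  assumes a: "continuous_on {0..} a"
  shows "\<exists>x. continuous_on {0..} x \<and> (\<forall>t\<ge>0. x t = integral {0..t} (\<lambda>s. F *v x s) + a t)"
proof -
  obtain c where c: "0 < c" "\<And>x. norm (F *v x) \<le> c * norm x"
    by (rule norm_matrix_bound[of F]) blast
  have cont: "continuous_on {0..T} (picard F a k)" for T k
    by (rule continuous_on_subset[OF continuous_on_picard[OF a]]) auto
  have contF: "continuous_on {0..T} (\<lambda>s. F *v picard F a k s)" for T k
    by (rule continuous_on_matrix_mult[OF cont])
  define x where "x = (\<lambda>t. \<Sum>k. picard F a k t)"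
  have unif: "uniform_limit {0..T} (\<lambda>n t. \<Sum>k<n. picard F a k t) x sequentially" for T
  proof (cases "0 \<le> T")
    case True
    have "compact (a ` {0..T})"
      using cont[of T 0] by (intro compact_continuous_image) auto
    then obtain C where C: "0 < C" "\<And>t. t \<in> {0..T} \<Longrightarrow> norm (a t) \<le> C"
      using compact_imp_bounded bounded_pos by (metis image_eqI)
    have bound: "norm (picard F a k t) \<le> C * ((c * t) ^ k / fact k)" if "t \<in> {0..T}" for k t
      using that
    proof (induction k arbitrary: t)
      case 0
      then show ?case using C by simp
    next
      case (Suc k)
      let ?p = "\<lambda>s. C * ((c * s) ^ Suc k / fact (Suc k))"
      have "((\<lambda>s. c * (C * ((c * s) ^ k / fact k))) has_integral (?p t - ?p 0)) {0..t}"
      proof (rule fundamental_theorem_of_calculus)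
        fix s
        have "(?p has_real_derivative c * (C * (real (Suc k) * (c * s) ^ k / fact (Suc k)))) (at s within {0..t})"
          by (auto intro!: derivative_eq_intros simp del: power_Suc fact_Suc of_nat_Suc)
        moreover have "real (Suc k) * (c * s) ^ k / fact (Suc k) = (c * s) ^ k / fact k"
          by (simp del: of_nat_Suc)
        ultimately show "(?p has_vector_derivative c * (C * ((c * s) ^ k / fact k))) (at s within {0..t})"
          unfolding has_real_derivative_iff_has_vector_derivative[symmetric] by (simp only:)
      qed (use Suc.prems in auto)
      then have I: "((\<lambda>s. c * (C * ((c * s) ^ k / fact k))) has_integral ?p t) {0..t}"
        by simp
      have "norm (integral {0..t} (\<lambda>s. F *v picard F a k s))
          \<le> integral {0..t} (\<lambda>s. c * (C * ((c * s) ^ k / fact k)))"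
      proof (rule integral_norm_bound_integral)
        show "norm (F *v picard F a k s) \<le> c * (C * ((c * s) ^ k / fact k))" if "s \<in> {0..t}" for s
        proof -
          have "norm (picard F a k s) \<le> C * ((c * s) ^ k / fact k)"
            using that Suc.prems by (intro Suc.IH) auto
          then show ?thesis using c(1) by (intro order_trans[OF c(2)] mult_left_mono) auto
        qed
      qed (use I contF in \<open>auto intro: integrable_continuous_interval\<close>)
      then show ?case by (simp only: picard.simps integral_unique[OF I])
    qed
    show ?thesis
      unfolding x_def
    proof (rule Weierstrass_m_test)
      show "norm (picard F a k t) \<le> C * ((c * T) ^ k / fact k)" if "t \<in> {0..T}" for k t
        using that c(1) C(1)
        by (intro order_trans[OF bound[OF that]] mult_left_mono divide_right_mono power_mono) auto
      show "summable (\<lambda>k. C * ((c * T) ^ k / fact k))"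
        using summable_exp_generic[of "c * T"]
        by (intro summable_mult) (simp add: divide_inverse mult.commute)
    qed
  qed auto
  have contx: "continuous_on {0..T} x" for T
    by (rule uniform_limit_theorem[OF _ unif]) (auto intro!: always_eventually continuous_on_sum cont)
  have "x t = integral {0..t} (\<lambda>s. F *v x s) + a t" if t: "0 \<le> t" for t
  proof -
    have "uniform_limit {0..t} (\<lambda>n s. F *v (\<Sum>k<n. picard F a k s)) (\<lambda>s. F *v x s) sequentially"
      by (rule bounded_linear.uniform_limit[OF matrix_vector_mul_bounded_linear unif])
    then obtain I J where IJ:
      "\<And>n. ((\<lambda>s. F *v (\<Sum>k<n. picard F a k s)) has_integral I n) {0..t}"
      "((\<lambda>s. F *v x s) has_integral J) {0..t}" "I \<longlonglongrightarrow> J"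
      by (rule uniform_limit_integral) (auto intro!: continuous_on_matrix_mult continuous_on_sum cont)
    have "I n = (\<Sum>k<n. picard F a (Suc k) t)" for n
    proof -
      have "I n = integral {0..t} (\<lambda>s. \<Sum>k<n. F *v picard F a k s)"
        using IJ(1)[of n] by (simp add: integral_unique linear_sum[OF matrix_vector_mul_linear])
      also have "\<dots> = (\<Sum>k<n. picard F a (Suc k) t)"
        by (subst integral_sum) (auto intro: integrable_continuous_interval contF)
      finally show ?thesis .
    qed
    \<comment> \<open>The index shift matches the first n + 1 terms with the forcing
      \<open>a\<close> plus the integral of the first n terms; letting n grow gives the
      equation.\<close>
    then have "(\<Sum>k<Suc n. picard F a k t) = a t + I n" for n
      unfolding sum.lessThan_Suc_shift by simp
    then have "(\<lambda>n. \<Sum>k<Suc n. picard F a k t) \<longlonglongrightarrow> a t + J"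
      using tendsto_add[OF tendsto_const IJ(3)] by simp
    moreover have "(\<lambda>n. \<Sum>k<Suc n. picard F a k t) \<longlonglongrightarrow> x t"
      using tendsto_uniform_limitI[OF unif[of t], of t] t by (intro LIMSEQ_Suc) auto
    ultimately have "x t = a t + J" by (rule LIMSEQ_unique[rotated])
    then show ?thesis using IJ(2) by (simp add: integral_unique)
  qed
  with continuous_on_nonneg_reals[OF contx] show ?thesis by blast
qed

subsection \<open>Matrices and traces\<close>

text \<open>Polarisation: by symmetry the cross term of the form at x + y is twice the bilinear
  form.\<close>

lemma symmetric_matrix_zero_if_quadratic_zero:
  fixes H :: "real ^ 'n ^ 'n"
  assumes sym: "transpose H = H" and q: "\<And>x. x \<bullet> (H *v x) = 0"
  shows "H = 0"
proof -
  have "y \<bullet> (H *v x) = 0" for x y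
  proof -
    have "x \<bullet> (H *v y) = y \<bullet> (H *v x)"
      using sym by (metis inner_commute inner_transpose_mult)
    then show ?thesis
      using q[of "x + y"] q[of x] q[of y]
      by (simp add: matrix_vector_right_distrib inner_add_left inner_add_right)
  qed
  then have "H *v x = 0 *v x" for x
    using inner_eq_zero_iff[of "H *v x"] by simp
  then show ?thesis by (metis matrix_eq)
qed

lemma trace_transpose: "trace (transpose A) = trace (A :: real ^ 'n ^ 'n)"
  by (simp add: trace_def transpose_def)

lemma transpose_add: "transpose (A + B) = transpose A + transpose (B :: real ^ 'n ^ 'm)"
  and transpose_diff: "transpose (A - B) = transpose A - transpose B"
  by (simp_all add: transpose_def vec_eq_iff)

lemma matrix_add_rdistrib: "(A + B) ** C = A ** C + B ** C"
  and matrix_diff_rdistrib: "(A - B) ** C = A ** C - B ** C"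
  for A B :: "real ^ 'n ^ 'm" and C :: "real ^ 'k ^ 'n"
  by (simp_all add: matrix_matrix_mult_def vec_eq_iff algebra_simps sum.distrib sum_subtractf)

lemma matrix_diff_ldistrib: "A ** (B - C) = A ** B - A ** C"
  for A :: "real ^ 'n ^ 'm" and B C :: "real ^ 'k ^ 'n"
  by (simp add: matrix_matrix_mult_def vec_eq_iff algebra_simps sum_subtractf)

text \<open>Written row by row, the trace is visibly nonnegative for a positive semidefinite
  \<open>S\<close>, and it matches the sum of second moments that makes up the expected
  cost.\<close>

lemma trace_gram:
  fixes D :: "real ^ 'n ^ 'm" and S :: "real ^ 'n ^ 'n"
  shows "trace (D ** S ** transpose D) = (\<Sum>i\<in>UNIV. row i D \<bullet> (S *v row i D))"
proof -
  have "(D ** S ** transpose D) $ i $ i = row i D \<bullet> (S *v row i D)" for i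
    by (simp add: matrix_matrix_mult_def matrix_vector_mult_def inner_vec_def row_def transpose_def
        sum_distrib_left sum_distrib_right mult_ac)
      (subst sum.swap, simp add: mult_ac)
  then show ?thesis by (simp add: trace_def)
qed

text \<open>This is Pythagoras for the semi-inner product trace (X S Y') on gains: the difference of
  two gains with the same Lyapunov data is orthogonal to the gain B'P.\<close>

lemma trace_feedback_minimal:
  fixes A S P :: "real ^ 'n ^ 'n" and B :: "real ^ 'm ^ 'n" and Q :: "real ^ 'n ^ 'n"
    and K :: "real ^ 'n ^ 'm"
  assumes S: "transpose S = S" "\<And>x. 0 \<le> x \<bullet> (S *v x)" and P: "transpose P = P"
    and lyap_P: "(A - B ** transpose B ** P) ** S + S ** transpose (A - B ** transpose B ** P) + Q = 0"
    and lyap_K: "(A - B ** K) ** S + S ** transpose (A - B ** K) + Q = 0"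
  shows "trace (transpose B ** P ** S ** transpose (transpose B ** P)) \<le> trace (K ** S ** transpose K)"
proof -
  define L where "L = transpose B ** P"
  define D where "D = K - L"
  have K: "K = L + D" by (simp add: D_def)
  have LT: "transpose L = P ** B"
    using P by (simp add: L_def matrix_transpose_mul)
  have "B ** D ** S + S ** transpose (B ** D) =
      ((A - B ** L) ** S + S ** transpose (A - B ** L) + Q)
      - ((A - B ** K) ** S + S ** transpose (A - B ** K) + Q)"
    unfolding K by (simp add: algebra_simps transpose_diff matrix_add_ldistrib matrix_add_rdistrib
        matrix_diff_ldistrib matrix_diff_rdistrib matrix_transpose_mul transpose_add)
  then have zero: "B ** D ** S + S ** transpose (B ** D) = 0"
    using lyap_P lyap_K by (simp add: L_def matrix_mul_assoc)
  \<comment> \<open>Transposition and cyclicity show that both summands of \<open>zero\<close>,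
    multiplied by \<open>P\<close>, have the same trace. Hence twice that trace is the trace of the
    zero matrix.\<close>
  have "trace (S ** transpose (B ** D) ** P) = trace (transpose (S ** transpose (B ** D) ** P))"
    by (simp add: trace_transpose)
  also have "\<dots> = trace (P ** (B ** D ** S))"
    using S(1) P by (simp add: matrix_transpose_mul matrix_mul_assoc)
  also have "\<dots> = trace (B ** D ** S ** P)"
    by (rule trace_mul_sym)
  finally have "2 * trace (B ** D ** S ** P) = trace ((B ** D ** S + S ** transpose (B ** D)) ** P)"
    by (simp add: matrix_add_rdistrib trace_add)
  then have "trace (B ** D ** S ** P) = 0"
    by (simp add: zero trace_def)
  \<comment> \<open>Cyclicity moves \<open>B\<close> to the end, where P B is the transpose of
    \<open>L\<close>.\<close>
  then have cross: "trace (D ** S ** transpose L) = 0"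
    unfolding LT by (metis trace_mul_sym matrix_mul_assoc)
  have "trace (L ** S ** transpose D) = trace (transpose (L ** S ** transpose D))"
    by (simp add: trace_transpose)
  also have "\<dots> = 0"
    using cross S(1) by (simp add: matrix_transpose_mul matrix_mul_assoc)
  finally have cross': "trace (L ** S ** transpose D) = 0" .
  have "K ** S ** transpose K = L ** S ** transpose L + L ** S ** transpose D
      + (D ** S ** transpose L + D ** S ** transpose D)"
    unfolding K by (simp add: transpose_add matrix_add_ldistrib matrix_add_rdistrib)
  then have "trace (K ** S ** transpose K) = trace (L ** S ** transpose L) + trace (D ** S ** transpose D)"
    using cross cross' by (simp add: trace_add)
  then show ?thesis
    using S(2) by (simp add: L_def trace_gram[of D] sum_nonneg)
qed

subsection \<open>Characteristic functions and Gaussian smoothing\<close>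

definition charfun :: "(real ^ 'n) measure \<Rightarrow> real ^ 'n \<Rightarrow> complex" where
  "charfun \<mu> \<theta> = (CLINT x|\<mu>. iexp (\<theta> \<bullet> x))"

section \<open>Normal vectors with independent coordinates\<close>

definition normal_vec_density :: "real \<Rightarrow> real ^ 'n \<Rightarrow> real" where
  "normal_vec_density \<sigma> z = (\<Prod>i\<in>UNIV. normal_density 0 \<sigma> (z $ i))"

lemma normal_vec_density_nonneg [simp]: "0 < \<sigma> \<Longrightarrow> 0 \<le> normal_vec_density \<sigma> z"
  by (simp add: normal_vec_density_def prod_nonneg)

lemma measurable_normal_vec_density [measurable]: "normal_vec_density \<sigma> \<in> borel_measurable borel"
  unfolding normal_vec_density_def[abs_def] by measurable

lemma normal_vec_density_1:
  "normal_vec_density 1 z = (2 * pi) powr (- real CARD('n) / 2) * exp (- (norm z)\<^sup>2 / 2)"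
  for z :: "real ^ 'n"
proof -
  have "normal_vec_density 1 z = (1 / sqrt (2 * pi)) ^ CARD('n) * exp (\<Sum>i\<in>UNIV. - (z $ i)\<^sup>2 / 2)"
    by (simp add: normal_vec_density_def normal_density_def prod.distrib exp_sum prod_dividef power_one_over)
  also have "(1 / sqrt (2 * pi)) ^ CARD('n) = (2 * pi) powr (- real CARD('n) / 2)"
  proof -
    have "1 / sqrt (2 * pi) = (2 * pi) powr (- (1 / 2))"
      by (simp only: powr_minus_divide powr_half_sqrt pi_ge_zero mult_nonneg_nonneg zero_le_numeral)
    then show ?thesis
      using powr_power[of "2 * pi" "- (1 / 2)" "CARD('n)"] by (simp only:) simp
  qed
  also have "(\<Sum>i\<in>UNIV. - (z $ i)\<^sup>2 / 2) = - (norm z)\<^sup>2 / 2"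
    unfolding power2_norm_eq_inner
    by (simp add: inner_vec_def sum_negf sum_divide_distrib power2_eq_square)
  finally show ?thesis .
qed

lemma prod_Basis_vec: "(\<Prod>b\<in>Basis. f (x \<bullet> b) b) = (\<Prod>i\<in>UNIV. f (x $ i) (axis i 1))"
  for x :: "real ^ 'n" and f :: "real \<Rightarrow> real ^ 'n \<Rightarrow> 'b::comm_monoid_mult"
proof -
  have B: "(Basis :: (real ^ 'n) set) = (\<lambda>i. axis i 1) ` UNIV"
    by (auto simp: Basis_vec_def)
  have inj: "inj (\<lambda>i :: 'n. axis i (1 :: real))"
    by (auto simp: inj_def axis_eq_axis)
  show ?thesis
    unfolding B prod.reindex[OF inj] by (simp add: inner_axis)
qed

lemma lborel_integral_prod:
  fixes f :: "'n::finite \<Rightarrow> real \<Rightarrow> complex"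
  assumes f: "\<And>i. integrable lborel (f i)"
  shows "(LINT z|lborel. (\<Prod>i\<in>UNIV. f i ((z :: real ^ 'n) $ i))) = (\<Prod>i\<in>UNIV. LINT x|lborel. f i x)"
    and "integrable lborel (\<lambda>z :: real ^ 'n. \<Prod>i\<in>UNIV. f i (z $ i))"
proof -
  interpret product_sigma_finite "\<lambda>_ :: real ^ 'n. lborel :: real measure" ..
  \<comment> \<open>\<open>lborel\<close> is the image of a product measure indexed by
    \<open>Basis\<close>, so \<open>ix\<close> recovers the coordinate index from a basis
    vector.\<close>
  define ix where "ix = inv (\<lambda>i :: 'n. axis i (1 :: real))"
  have "inj (\<lambda>i :: 'n. axis i (1 :: real))"
    by (auto simp: inj_def axis_eq_axis)
  then have ix: "ix (axis i 1) = i" for i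
    unfolding ix_def by (rule inv_f_f)
  have [measurable]: "f i \<in> borel_measurable borel" for i
    using f[of i] by (simp add: integrable_iff_bounded)
  have eq: "(\<Prod>i\<in>UNIV. f i (z $ i)) = (\<Prod>b\<in>Basis. f (ix b) (z \<bullet> b))" for z :: "real ^ 'n"
    by (simp add: prod_Basis_vec[of "\<lambda>x b. f (ix b) x"] ix)
  have co: "(\<Sum>b\<in>Basis. g b *\<^sub>R b) \<bullet> c = g c" if "c \<in> Basis" for g and c :: "real ^ 'n"
    using that by (simp add: inner_sum_left inner_Basis if_distrib cong: if_cong)
  show "(LINT z|lborel. (\<Prod>i\<in>UNIV. f i ((z :: real ^ 'n) $ i))) = (\<Prod>i\<in>UNIV. LINT x|lborel. f i x)"
    unfolding eq
    apply (subst lborel_eq)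
    apply (subst integral_distr)
      apply measurable
    apply (simp add: co product_integral_prod[of Basis "\<lambda>b. f (ix b)"] f)
    using prod_Basis_vec[of "\<lambda>_ b. LINT x|lborel. f (ix b) x" 0] by (simp add: ix)
  show "integrable lborel (\<lambda>z :: real ^ 'n. \<Prod>i\<in>UNIV. f i (z $ i))"
    unfolding eq
    apply (subst lborel_eq)
    apply (subst integrable_distr_eq)
      apply measurable
    by (simp add: co product_integrable_prod[of Basis "\<lambda>b. f (ix b)"] f)
qed

lemma normal_density_iexp:
  assumes "0 < \<sigma>"
  shows "integrable lborel (\<lambda>x. complex_of_real (normal_density 0 \<sigma> x) * iexp (t * x))"
    and "(LINT x|lborel. complex_of_real (normal_density 0 \<sigma> x) * iexp (t * x)) =
      exp (- (\<sigma> * t)\<^sup>2 / 2)"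
proof -
  have i: "integrable lborel (\<lambda>x. complex_of_real (normal_density 0 s x) * iexp (u * x))" if "0 < s" for s u
  proof (rule Bochner_Integration.integrable_bound)
    show "integrable lborel (normal_density 0 s)" using that by simp
  qed (auto simp: norm_mult)
  then show "integrable lborel (\<lambda>x. complex_of_real (normal_density 0 \<sigma> x) * iexp (t * x))"
    using assms .
  have std: "(LINT x|lborel. complex_of_real (std_normal_density x) * iexp (u * x)) = exp (- u\<^sup>2 / 2)" for u
    using fun_cong[OF char_std_normal_distribution, of u]
    by (simp add: char_def integral_density scaleR_conv_of_real)
  have scale: "\<sigma> * normal_density 0 \<sigma> (\<sigma> * x) = std_normal_density x" for x
    using assms by (simp add: normal_density_def real_sqrt_mult power_mult_distrib)
  \<comment> \<open>The substitution x = \<sigma> x' reduces the claim to the standard normal law at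
    frequency \<sigma> t.\<close>
  have "(LINT x|lborel. complex_of_real (normal_density 0 \<sigma> x) * iexp (t * x))
      = \<sigma> *\<^sub>R (LINT x|lborel. complex_of_real (normal_density 0 \<sigma> (\<sigma> * x)) * iexp (t * (\<sigma> * x)))"
    using lborel_integral_real_affine[of \<sigma> "\<lambda>x. complex_of_real (normal_density 0 \<sigma> x) * iexp (t * x)" 0]
      assms by simp
  also have "\<dots> = (LINT x|lborel. complex_of_real (std_normal_density x) * iexp ((\<sigma> * t) * x))"
    unfolding scale[symmetric] by (subst integral_scaleR_right[symmetric])
      (simp add: scaleR_conv_of_real mult_ac)
  finally show "(LINT x|lborel. complex_of_real (normal_density 0 \<sigma> x) * iexp (t * x)) =
      exp (- (\<sigma> * t)\<^sup>2 / 2)"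
    unfolding std .
qed

lemma charfun_normal_vec:
  assumes "0 < \<sigma>"
  shows "integrable lborel (\<lambda>z :: real ^ 'n. complex_of_real (normal_vec_density \<sigma> z) * iexp (\<theta> \<bullet> z))"
    and "(LINT z|lborel. complex_of_real (normal_vec_density \<sigma> z) * iexp (\<theta> \<bullet> z)) =
      exp (- \<sigma>\<^sup>2 * (norm (\<theta> :: real ^ 'n))\<^sup>2 / 2)"
proof -
  have eq: "complex_of_real (normal_vec_density \<sigma> z) * iexp (\<theta> \<bullet> z) =
      (\<Prod>i\<in>UNIV. complex_of_real (normal_density 0 \<sigma> (z $ i)) * iexp (\<theta> $ i * z $ i))" for z
    by (simp add: normal_vec_density_def prod.distrib inner_vec_def sum_distrib_left exp_sum)
  show "integrable lborel (\<lambda>z :: real ^ 'n. complex_of_real (normal_vec_density \<sigma> z) * iexp (\<theta> \<bullet> z))"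
    unfolding eq by (rule lborel_integral_prod normal_density_iexp assms)+
  have "(LINT z|lborel. complex_of_real (normal_vec_density \<sigma> z) * iexp (\<theta> \<bullet> z))
      = (\<Prod>i\<in>UNIV. complex_of_real (exp (- (\<sigma> * \<theta> $ i)\<^sup>2 / 2)))"
    unfolding eq
    by (subst lborel_integral_prod(1)) (simp_all only: normal_density_iexp[OF assms])
  also have "\<dots> = complex_of_real (exp (\<Sum>i\<in>UNIV. - (\<sigma> * \<theta> $ i)\<^sup>2 / 2))"
    by (simp add: exp_sum)
  also have "(\<Sum>i\<in>UNIV. - (\<sigma> * \<theta> $ i)\<^sup>2 / 2) = - \<sigma>\<^sup>2 * (norm \<theta>)\<^sup>2 / 2"
    unfolding power2_norm_eq_inner
    by (simp add: inner_vec_def sum_negf sum_divide_distrib sum_distrib_left power2_eq_square mult_ac)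
  finally show "(LINT z|lborel. complex_of_real (normal_vec_density \<sigma> z) * iexp (\<theta> \<bullet> z)) =
      exp (- \<sigma>\<^sup>2 * (norm \<theta>)\<^sup>2 / 2)" by simp
qed

lemma charfun_normal_vec_measure:
  assumes "0 < \<sigma>"
  shows "charfun (density lborel (normal_vec_density \<sigma>)) \<theta> = exp (- \<sigma>\<^sup>2 * (norm \<theta>)\<^sup>2 / 2)"
  using assms charfun_normal_vec(2)[OF assms, of \<theta>]
  by (simp add: charfun_def integral_density scaleR_conv_of_real)

lemma prob_space_normal_vec:
  assumes "0 < \<sigma>"
  shows "prob_space (density lborel (normal_vec_density \<sigma> :: real ^ 'n \<Rightarrow> real))"
proof
  let ?f = "normal_vec_density \<sigma> :: real ^ 'n \<Rightarrow> real"
  have "integrable lborel (\<lambda>z. complex_of_real (?f z))"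
    using charfun_normal_vec(1)[OF assms, of 0] by simp
  then have i: "integrable lborel ?f" by (simp add: complex_of_real_integrable_eq)
  have "complex_of_real (LINT z|lborel. ?f z) = 1"
    using charfun_normal_vec(2)[OF assms, where 'n='n, of 0] by (simp flip: integral_complex_of_real)
  then have "(LINT z|lborel. ?f z) = 1" by (simp only: of_real_eq_1_iff)
  then show "emeasure (density lborel ?f) (space (density lborel ?f)) = 1"
    using assms by (simp add: emeasure_density nn_integral_eq_integral[OF i])
qed

text \<open>Averaging \<open>f\<close> over a Gaussian neighbourhood of width \<open>1 / \<sigma>\<close> turns its expectation into an expression
  in the characteristic function alone, because a Gaussian kernel is itself a Fourier transform.\<close>

lemma smoothed_expectation:
  fixes \<mu> :: "(real ^ 'n) measure" and f :: "real ^ 'n \<Rightarrow> real"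
  assumes \<mu>: "prob_space \<mu>" "sets \<mu> = sets borel" and \<sigma>: "0 < \<sigma>"
    and [measurable]: "f \<in> borel_measurable borel"
  shows "(\<integral>\<^sup>+x. (\<integral>\<^sup>+z. ennreal (f (x + (1 / \<sigma>) *\<^sub>R z)) * ennreal (exp (- (norm z)\<^sup>2 / 2)) \<partial>lborel) \<partial>\<mu>) =
    ennreal (\<sigma> ^ CARD('n)) * (\<integral>\<^sup>+y. ennreal (f y) *
      ennreal (Re (CLINT z|lborel. complex_of_real (normal_vec_density \<sigma> z) * (iexp (- (z \<bullet> y)) * charfun \<mu> z))) \<partial>lborel)"
proof -
  interpret prob_space \<mu> by fact
  interpret pair_sigma_finite \<mu> "lborel :: (real ^ 'n) measure" ..
  note \<mu>(2)[measurable_cong]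
  \<comment> \<open>By \<open>charfun_normal_vec\<close>, \<open>K y x\<close> is the Fourier
    transform of \<open>normal_vec_density \<sigma>\<close> at x - y.\<close>
  define K where "K = (\<lambda>y x :: real ^ 'n. exp (- \<sigma>\<^sup>2 * (norm (x - y))\<^sup>2 / 2))"
  have K_nonneg: "0 \<le> K y x" for x y by (simp add: K_def)
  have [measurable]: "case_prod K \<in> borel_measurable (borel \<Otimes>\<^sub>M borel)"
    unfolding K_def by measurable
  \<comment> \<open>Fubini: integrating first over z gives the kernel \<open>K\<close>, integrating
    first over x gives the characteristic function. The density in z dominates, since the
    exponential factor has modulus 1.\<close>
  have inner: "(CLINT z|lborel. complex_of_real (normal_vec_density \<sigma> z) * (iexp (- (z \<bullet> y)) * charfun \<mu> z))
      = complex_of_real (LINT x|\<mu>. K y x)" for y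
  proof -
    let ?h = "\<lambda>(x, z). complex_of_real (normal_vec_density \<sigma> z) * iexp ((x - y) \<bullet> z)"
    have h: "integrable (\<mu> \<Otimes>\<^sub>M lborel) ?h"
    proof (rule Fubini_integrable)
      show "?h \<in> borel_measurable (\<mu> \<Otimes>\<^sub>M lborel)" by measurable
      have n: "norm (?h (x, z)) = normal_vec_density \<sigma> z" for x z
        using \<sigma> by (simp add: norm_mult)
      show "integrable \<mu> (\<lambda>x. LINT z|lborel. norm (?h (x, z)))"
        unfolding n by simp
      show "AE x in \<mu>. integrable lborel (\<lambda>z. ?h (x, z))"
        using charfun_normal_vec(1)[OF \<sigma>, of "_ - y"] by simp
    qed
    have "(CLINT z|lborel. complex_of_real (normal_vec_density \<sigma> z) * (iexp (- (z \<bullet> y)) * charfun \<mu> z))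
        = (CLINT z|lborel. CLINT x|\<mu>. ?h (x, z))"
    proof (rule Bochner_Integration.integral_cong[OF refl])
      fix z :: "real ^ 'n"
      have "complex_of_real (normal_vec_density \<sigma> z) * (iexp (- (z \<bullet> y)) * charfun \<mu> z) =
        (CLINT x|\<mu>. complex_of_real (normal_vec_density \<sigma> z) * (iexp (- (z \<bullet> y)) * iexp (z \<bullet> x)))"
        unfolding charfun_def by (subst integral_mult_right_zero)+ simp
      also have "\<dots> = (CLINT x|\<mu>. ?h (x, z))"
        by (intro Bochner_Integration.integral_cong)
          (auto simp: exp_add[symmetric] inner_diff_left inner_commute algebra_simps)
      finally show "complex_of_real (normal_vec_density \<sigma> z) * (iexp (- (z \<bullet> y)) * charfun \<mu> z) = \<dots>" .
    qed
    also have "\<dots> = (CLINT x|\<mu>. CLINT z|lborel. ?h (x, z))"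
      using Fubini_integral[of "\<lambda>x z. ?h (x, z)"] h by simp
    also have "\<dots> = (CLINT x|\<mu>. complex_of_real (K y x))"
      using charfun_normal_vec(2)[OF \<sigma>, of "_ - y"] by (simp add: K_def)
    finally show ?thesis by simp
  qed
  have Kint: "integrable \<mu> (K y)" for y
    by (rule integrable_const_bound[of _ 1]) (auto simp: K_def)
  \<comment> \<open>Substitution of y = x + z / \<sigma>, whose Jacobian is the factor in
    front.\<close>
  have sub: "(\<integral>\<^sup>+z. ennreal (f (x + (1 / \<sigma>) *\<^sub>R z)) * ennreal (exp (- (norm z)\<^sup>2 / 2)) \<partial>lborel) =
      ennreal (\<sigma> ^ CARD('n)) * (\<integral>\<^sup>+y. ennreal (f y) * ennreal (K y x) \<partial>lborel)" for x
  proof -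
    let ?g = "\<lambda>z. ennreal (f (x + (1 / \<sigma>) *\<^sub>R z)) * ennreal (exp (- (norm z)\<^sup>2 / 2))"
    have l: "lborel = density (distr lborel borel (\<lambda>y. (- \<sigma> *\<^sub>R x) + \<sigma> *\<^sub>R y)) (\<lambda>_ :: real ^ 'n. ennreal (\<sigma> ^ CARD('n)))"
      using lborel_affine[of \<sigma> "- \<sigma> *\<^sub>R x"] \<sigma> by simp
    have "(\<integral>\<^sup>+z. ?g z \<partial>lborel) = ennreal (\<sigma> ^ CARD('n)) * (\<integral>\<^sup>+y. ?g (- \<sigma> *\<^sub>R x + \<sigma> *\<^sub>R y) \<partial>lborel)"
      by (subst l) (simp add: nn_integral_density nn_integral_distr nn_integral_cmult)
    moreover have "?g (- \<sigma> *\<^sub>R x + \<sigma> *\<^sub>R y) = ennreal (f y) * ennreal (K y x)" for y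
    proof -
      have "- \<sigma> *\<^sub>R x + \<sigma> *\<^sub>R y = - (\<sigma> *\<^sub>R (x - y))"
        by (simp add: algebra_simps)
      then have "(norm (- \<sigma> *\<^sub>R x + \<sigma> *\<^sub>R y))\<^sup>2 = \<sigma>\<^sup>2 * (norm (x - y))\<^sup>2"
        by (simp only: norm_minus_cancel norm_scaleR power_mult_distrib power2_abs)
      moreover have "x + (1 / \<sigma>) *\<^sub>R (- \<sigma> *\<^sub>R x + \<sigma> *\<^sub>R y) = y"
        using \<sigma> by (simp add: scaleR_diff_right)
      ultimately show ?thesis unfolding K_def by (simp only:) simp
    qed
    ultimately show ?thesis by simp
  qed
  have "(\<integral>\<^sup>+x. (\<integral>\<^sup>+z. ennreal (f (x + (1 / \<sigma>) *\<^sub>R z)) * ennreal (exp (- (norm z)\<^sup>2 / 2)) \<partial>lborel) \<partial>\<mu>) =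
      ennreal (\<sigma> ^ CARD('n)) * (\<integral>\<^sup>+x. \<integral>\<^sup>+y. ennreal (f y) * ennreal (K y x) \<partial>lborel \<partial>\<mu>)"
    unfolding sub by (simp add: nn_integral_cmult)
  also have "(\<integral>\<^sup>+x. \<integral>\<^sup>+y. ennreal (f y) * ennreal (K y x) \<partial>lborel \<partial>\<mu>) =
      (\<integral>\<^sup>+y. \<integral>\<^sup>+x. ennreal (f y) * ennreal (K y x) \<partial>\<mu> \<partial>lborel)"
    by (rule Fubini'[symmetric]) measurable
  also have "\<dots> = (\<integral>\<^sup>+y. ennreal (f y) * ennreal (LINT x|\<mu>. K y x) \<partial>lborel)"
    by (simp add: nn_integral_cmult nn_integral_eq_integral[OF Kint] K_nonneg)
  finally show ?thesis
    unfolding inner by simp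
qed

text \<open>The smoothed expectations agree for every width 1 / (k + 1), and they tend to the plain
  ones times the Gaussian mass \<open>E\<close>. Both passages to the limit are dominated:
  \<open>ennreal\<close> sends negative values to 0, so \<open>f x \<le> 1\<close> bounds the
  integrand.\<close>

lemma charfun_determines_continuous_expectation:
  fixes \<mu> \<nu> :: "(real ^ 'n) measure" and f :: "real ^ 'n \<Rightarrow> real"
  assumes \<mu>: "prob_space \<mu>" "sets \<mu> = sets borel" and \<nu>: "prob_space \<nu>" "sets \<nu> = sets borel"
    and eq: "\<And>\<theta>. charfun \<mu> \<theta> = charfun \<nu> \<theta>"
    and cont: "continuous_on UNIV f" and f1: "\<And>x. f x \<le> 1"
  shows "(\<integral>\<^sup>+x. ennreal (f x) \<partial>\<mu>) = (\<integral>\<^sup>+x. ennreal (f x) \<partial>\<nu>)"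
proof -
  have [measurable]: "f \<in> borel_measurable borel"
    using cont by (rule borel_measurable_continuous_onI)
  define e where "e = (\<lambda>z :: real ^ 'n. ennreal (exp (- (norm z)\<^sup>2 / 2)))"
  have [measurable]: "e \<in> borel_measurable borel" unfolding e_def by measurable
  define I where "I = (\<lambda>(m :: (real ^ 'n) measure) k.
    \<integral>\<^sup>+x. (\<integral>\<^sup>+z. ennreal (f (x + (1 / real (Suc k)) *\<^sub>R z)) * e z \<partial>lborel) \<partial>m)"
  have Ieq: "I \<mu> k = I \<nu> k" for k
    unfolding I_def e_def
    by (subst (1 2) smoothed_expectation) (use \<mu> \<nu> eq in auto)
  define c where "c = (2 * pi) powr (- real CARD('n) / 2)"
  define E where "E = (\<integral>\<^sup>+z. e z \<partial>lborel)"
  have density: "normal_vec_density 1 z = c * exp (- (norm z)\<^sup>2 / 2)" for z :: "real ^ 'n"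
    by (simp only: normal_vec_density_1 c_def)
  have c: "0 < c" by (simp add: c_def)
  interpret N: prob_space "density lborel (normal_vec_density 1 :: real ^ 'n \<Rightarrow> real)"
    by (rule prob_space_normal_vec) simp
  have "1 = (\<integral>\<^sup>+z. ennreal (normal_vec_density 1 (z :: real ^ 'n)) \<partial>lborel)"
    using N.emeasure_space_1 by (simp add: emeasure_density)
  also have "\<dots> = ennreal c * E"
    using c by (simp add: density E_def e_def ennreal_mult nn_integral_cmult)
  finally have cE: "ennreal c * E = 1" by simp
  then have E: "E < \<infinity>"
    using c by (auto simp: less_top[symmetric] ennreal_mult_top)
  have lim: "I m \<longlonglongrightarrow> (\<integral>\<^sup>+x. ennreal (f x) \<partial>m) * E"
    if m: "prob_space m" "sets m = sets borel" for m
  proof -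
    interpret m: prob_space m by fact
    interpret pair_sigma_finite m "lborel :: (real ^ 'n) measure" ..
    note m(2)[measurable_cong]
    have bound: "ennreal (f y) * e z \<le> e z" for y z
      using mult_right_mono[of "ennreal (f y)" 1 "e z"] f1[of y] by simp
    have inner: "(\<lambda>k. \<integral>\<^sup>+z. ennreal (f (x + (1 / real (Suc k)) *\<^sub>R z)) * e z \<partial>lborel) \<longlonglongrightarrow> ennreal (f x) * E" for x
    proof -
      have "(\<lambda>k. \<integral>\<^sup>+z. ennreal (f (x + (1 / real (Suc k)) *\<^sub>R z)) * e z \<partial>lborel)
          \<longlonglongrightarrow> (\<integral>\<^sup>+z. ennreal (f x) * e z \<partial>lborel)"
      proof (rule nn_integral_dominated_convergence[where w = e])
        have "(\<lambda>k. x + (1 / real (Suc k)) *\<^sub>R z) \<longlonglongrightarrow> x + 0 *\<^sub>R z" for z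
          using LIMSEQ_inverse_real_of_nat by (intro tendsto_add tendsto_scaleR tendsto_const) (simp add: inverse_eq_divide)
        then have "(\<lambda>k. f (x + (1 / real (Suc k)) *\<^sub>R z)) \<longlonglongrightarrow> f x" for z
          using cont by (intro isCont_tendsto_compose[of _ f]) (auto simp: continuous_on_eq_continuous_at)
        then have "(\<lambda>k. ennreal (f (x + (1 / real (Suc k)) *\<^sub>R z)) * e z) \<longlonglongrightarrow> ennreal (f x) * e z" for z
          unfolding e_def by (subst (1 2) ennreal_mult''[symmetric])
            (auto intro!: tendsto_ennrealI tendsto_mult)
        then show "AE z in lborel. (\<lambda>k. ennreal (f (x + (1 / real (Suc k)) *\<^sub>R z)) * e z) \<longlonglongrightarrow> ennreal (f x) * e z"
          by simp
      qed (use E bound in \<open>simp_all add: E_def\<close>)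
      then show ?thesis by (simp add: nn_integral_cmult E_def)
    qed
    have "I m \<longlonglongrightarrow> (\<integral>\<^sup>+x. ennreal (f x) * E \<partial>m)"
      unfolding I_def
    proof (rule nn_integral_dominated_convergence[where w = "\<lambda>_. E"])
      show "AE x in m. (\<integral>\<^sup>+z. ennreal (f (x + (1 / real (Suc k)) *\<^sub>R z)) * e z \<partial>lborel) \<le> E" for k
        unfolding E_def by (intro AE_I2 nn_integral_mono bound)
      show "(\<integral>\<^sup>+x. E \<partial>m) < \<infinity>" using E by (simp add: m.emeasure_space_1)
    qed (use inner in auto)
    then show ?thesis by (simp add: nn_integral_multc)
  qed
  have "(\<integral>\<^sup>+x. ennreal (f x) \<partial>\<mu>) * E = (\<integral>\<^sup>+x. ennreal (f x) \<partial>\<nu>) * E"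
    using lim[OF \<mu>] lim[OF \<nu>] Ieq by (metis (no_types) LIMSEQ_unique ext)
  \<comment> \<open>As \<open>c * E = 1\<close>, multiplying by \<open>c\<close> removes the common
    factor \<open>E\<close>.\<close>
  then have "(\<integral>\<^sup>+x. ennreal (f x) \<partial>\<mu>) * E * ennreal c = (\<integral>\<^sup>+x. ennreal (f x) \<partial>\<nu>) * E * ennreal c"
    by simp
  then show ?thesis
    using cE by (simp add: mult.assoc mult.commute[of E])
qed

text \<open>Indicators of closed sets are limits of bounded continuous functions of the distance, so
  the two measures agree on closed sets. These form an intersection-stable generator of the Borel
  sets.\<close>

theorem charfun_unique:
  fixes \<mu> \<nu> :: "(real ^ 'n) measure"
  assumes \<mu>: "prob_space \<mu>" "sets \<mu> = sets borel" and \<nu>: "prob_space \<nu>" "sets \<nu> = sets borel"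
    and eq: "\<And>\<theta>. charfun \<mu> \<theta> = charfun \<nu> \<theta>"
  shows "\<mu> = \<nu>"
proof -
  \<comment> \<open>The empty set is excluded because \<open>infdist x {}\<close> is 0 by convention
    and the approximating functions would be constantly 1.\<close>
  have closed_lim: "(\<lambda>k. \<integral>\<^sup>+x. ennreal (max 0 (1 - real k * infdist x C)) \<partial>m) \<longlonglongrightarrow> emeasure m C"
    if m: "prob_space m" "sets m = sets borel" and C: "closed C" "C \<noteq> {}"
    for m :: "(real ^ 'n) measure" and C
  proof -
    interpret m: prob_space m by fact
    note m(2)[measurable_cong]
    have [measurable]: "C \<in> sets borel" using C by simp
    have [measurable]: "(\<lambda>x. infdist x C) \<in> borel_measurable borel"
      by (intro borel_measurable_continuous_onI continuous_intros)
    have "(\<lambda>k. \<integral>\<^sup>+x. ennreal (max 0 (1 - real k * infdist x C)) \<partial>m) \<longlonglongrightarrow> (\<integral>\<^sup>+x. indicator C x \<partial>m)"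
    proof (rule nn_integral_dominated_convergence[where w = "\<lambda>_. 1"])
      have "(\<lambda>k. ennreal (max 0 (1 - real k * infdist x C))) \<longlonglongrightarrow> indicator C x" for x
      proof (cases "x \<in> C")
        case True
        then show ?thesis by simp
      next
        case False
        then have d: "0 < infdist x C"
          using C by (simp add: infdist_pos_not_in_closed)
        obtain N where N: "1 / infdist x C < real N" using reals_Archimedean2 by blast
        have neg: "1 - real k * infdist x C \<le> 0" if "N \<le> k" for k
        proof -
          have "1 < real N * infdist x C" using N d by (simp add: field_simps)
          also have "\<dots> \<le> real k * infdist x C" using that d by (intro mult_right_mono) auto
          finally show ?thesis by simp
        qed
        then have "\<forall>\<^sub>F k in sequentially. ennreal (max 0 (1 - real k * infdist x C)) = indicator C x"
          using False by (intro eventually_sequentiallyI[of N]) (simp only: max_absorb1[OF neg], simp)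
        then show ?thesis by (rule tendsto_eventually)
      qed
      then show "AE x in m. (\<lambda>k. ennreal (max 0 (1 - real k * infdist x C))) \<longlonglongrightarrow> indicator C x"
        by simp
    qed (auto simp: m.emeasure_space_1 infdist_nonneg)
    then show ?thesis by simp
  qed
  show ?thesis
  proof (rule measure_eqI_generator_eq[where E = "Collect closed" and \<Omega> = UNIV and A = "\<lambda>_. UNIV"])
    fix C :: "(real ^ 'n) set" assume "C \<in> Collect closed"
    then have C: "closed C" by simp
    show "emeasure \<mu> C = emeasure \<nu> C"
    proof (cases "C = {}")
      case False
      have "(\<integral>\<^sup>+x. ennreal (max 0 (1 - real k * infdist x C)) \<partial>\<mu>) =
          (\<integral>\<^sup>+x. ennreal (max 0 (1 - real k * infdist x C)) \<partial>\<nu>)" for k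
        by (rule charfun_determines_continuous_expectation[OF \<mu> \<nu> eq])
          (auto intro!: continuous_intros simp: infdist_nonneg)
      then show ?thesis
        using closed_lim[OF \<mu> C False] closed_lim[OF \<nu> C False] by (simp add: LIMSEQ_unique)
    qed simp
  next
    show "emeasure \<mu> UNIV \<noteq> \<infinity>"
      using prob_space.emeasure_le_1[OF \<mu>(1), of UNIV] by (auto simp: top_unique)
  qed (auto simp: Int_stable_def \<mu>(2) \<nu>(2) borel_eq_closed)
qed

subsection \<open>Linear substitution and Gaussian measures\<close>

text \<open>The body copies the elementary matrix in \<open>induct_matrix_elementary\<close>. For
  distinct indices it adds c times coordinate n to coordinate m.\<close>

definition shear_matrix :: "'n \<Rightarrow> 'n \<Rightarrow> real \<Rightarrow> real ^ 'n ^ 'n" where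
  "shear_matrix m n c = (\<chi> i j. if i = m \<and> j = n then c else of_bool (i = j))"

lemma shear_matrix_mult:
  assumes "m \<noteq> n"
  shows "shear_matrix m n c *v x = x + (c * x $ n) *\<^sub>R axis m 1"
proof (subst vec_eq_iff, rule)
  fix i
  have "(\<Sum>j\<in>UNIV. (if i = m \<and> j = n then c else of_bool (i = j)) * x $ j) =
      (\<Sum>j\<in>UNIV. (if j = i then x $ j else 0) + (if j = n then of_bool (i = m) * c * x $ j else 0))"
    using assms by (intro sum.cong) auto
  then show "(shear_matrix m n c *v x) $ i = (x + (c * x $ n) *\<^sub>R axis m 1) $ i"
    by (simp add: shear_matrix_def matrix_vector_mult_def sum.distrib axis_def)
qed

lemma det_shear_matrix:
  assumes "m \<noteq> n"
  shows "det (shear_matrix m n c) = 1"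
proof -
  have "shear_matrix m n c = (\<chi> k. if k = m then row m (mat 1) + c *s row n (mat 1) else row k (mat 1))"
    using assms by (auto simp: shear_matrix_def vec_eq_iff row_def mat_def)
  then show ?thesis using det_row_operation[OF assms, of "mat 1" c] by simp
qed

text \<open>With the m-th coordinate integrated innermost, the shear is a translation of that
  coordinate by an amount depending only on the others, and Lebesgue measure on the line is
  translation invariant.\<close>

lemma nn_integral_shear:
  fixes f :: "real ^ 'n \<Rightarrow> ennreal"
  assumes [measurable]: "f \<in> borel_measurable borel" and mn: "m \<noteq> n"
  shows "(\<integral>\<^sup>+x. f (x + (c * x $ n) *\<^sub>R axis m 1) \<partial>lborel) = (\<integral>\<^sup>+x. f x \<partial>lborel)"
proof -
  interpret product_sigma_finite "\<lambda>_ :: real ^ 'n. lborel :: real measure" ..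
  let ?m = "axis m 1 :: real ^ 'n" and ?n = "axis n 1 :: real ^ 'n"
  let ?B = "Basis - {?m}"
  let ?s = "\<lambda>x. \<Sum>b\<in>Basis. x b *\<^sub>R b"
  have B: "Basis = insert ?m ?B" by auto
  have ne: "?n \<noteq> ?m" using mn by (simp add: axis_eq_axis)
  have upd: "?s (x(?m := y)) = y *\<^sub>R ?m + (\<Sum>b\<in>?B. x b *\<^sub>R b)" for x y
  proof -
    have "(\<Sum>b\<in>?B. (x(?m := y)) b *\<^sub>R b) = (\<Sum>b\<in>?B. x b *\<^sub>R b)"
      by (intro sum.cong) auto
    then show ?thesis by (subst B) (simp add: sum.insert_remove)
  qed
  have comp: "?s (x(?m := y)) $ n = x ?n" for x :: "real ^ 'n \<Rightarrow> real" and y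
  proof -
    have "?s (x(?m := y)) $ n = ?s (x(?m := y)) \<bullet> ?n" by (simp add: inner_axis)
    also have "\<dots> = (x(?m := y)) ?n"
      by (simp add: inner_sum_left inner_Basis if_distrib del: fun_upd_apply cong: if_cong)
    also have "\<dots> = x ?n"
      using ne by simp
    finally show ?thesis .
  qed
  have split: "(\<integral>\<^sup>+x. g x \<partial>lborel) =
      (\<integral>\<^sup>+x. \<integral>\<^sup>+y. g (?s (x(?m := y))) \<partial>lborel \<partial>Pi\<^sub>M ?B (\<lambda>_. lborel))"
    if [measurable]: "g \<in> borel_measurable borel" for g
  proof -
    have "(\<integral>\<^sup>+x. g x \<partial>lborel) = (\<integral>\<^sup>+x. g (?s x) \<partial>Pi\<^sub>M (insert ?m ?B) (\<lambda>_. lborel))"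
      unfolding B[symmetric] by (subst lborel_eq) (simp add: nn_integral_distr)
    also have "\<dots> = (\<integral>\<^sup>+x. \<integral>\<^sup>+y. g (?s (x(?m := y))) \<partial>lborel \<partial>Pi\<^sub>M ?B (\<lambda>_. lborel))"
      by (rule product_nn_integral_insert) (auto simp flip: B)
    finally show ?thesis .
  qed
  have shift: "?s (x(?m := y)) + (c * ?s (x(?m := y)) $ n) *\<^sub>R ?m =
      (c * x ?n + 1 * y) *\<^sub>R ?m + (\<Sum>b\<in>?B. x b *\<^sub>R b)" for x y
    unfolding comp unfolding upd by (simp add: algebra_simps)
  have "(\<integral>\<^sup>+x. f (x + (c * x $ n) *\<^sub>R axis m 1) \<partial>lborel) =
      (\<integral>\<^sup>+x. \<integral>\<^sup>+y. f ((c * x ?n + 1 * y) *\<^sub>R ?m + (\<Sum>b\<in>?B. x b *\<^sub>R b)) \<partial>lborel \<partial>Pi\<^sub>M ?B (\<lambda>_. lborel))"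
    by (subst split) (simp_all only: shift, measurable)
  also have "\<dots> = (\<integral>\<^sup>+x. \<integral>\<^sup>+y. f (y *\<^sub>R ?m + (\<Sum>b\<in>?B. x b *\<^sub>R b)) \<partial>lborel \<partial>Pi\<^sub>M ?B (\<lambda>_. lborel))"
  proof (rule nn_integral_cong)
    fix x
    show "(\<integral>\<^sup>+y. f ((c * x ?n + 1 * y) *\<^sub>R ?m + (\<Sum>b\<in>?B. x b *\<^sub>R b)) \<partial>lborel) =
        (\<integral>\<^sup>+y. f (y *\<^sub>R ?m + (\<Sum>b\<in>?B. x b *\<^sub>R b)) \<partial>lborel)"
      using nn_integral_real_affine[of "\<lambda>y. f (y *\<^sub>R ?m + (\<Sum>b\<in>?B. x b *\<^sub>R b))" 1 "c * x ?n"]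
      by simp
  qed
  also have "\<dots> = (\<integral>\<^sup>+x. f x \<partial>lborel)"
    by (subst split) (simp_all only: upd, measurable)
  finally show ?thesis .
qed

text \<open>The substitution rules of the library require a well-ordered index type; here it is only finite.\<close>

lemma nn_integral_linear_substitution:
  fixes A :: "real ^ 'n ^ 'n" and f :: "real ^ 'n \<Rightarrow> ennreal"
  assumes "det A \<noteq> 0" and "f \<in> borel_measurable borel"
  shows "ennreal \<bar>det A\<bar> * (\<integral>\<^sup>+x. f (A *v x) \<partial>lborel) = (\<integral>\<^sup>+x. f x \<partial>lborel)"
proof -
  \<comment> \<open>Nonvanishing determinant is a premise inside \<open>P\<close>: matrices with a
    zero row then satisfy \<open>P\<close> vacuously, and in a product it passes to both
    factors.\<close>
  define P where "P A \<longleftrightarrow> (det A \<noteq> 0 \<longrightarrow> (\<forall>f\<in>borel_measurable borel.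
    ennreal \<bar>det A\<bar> * (\<integral>\<^sup>+x. f (A *v x) \<partial>lborel) = (\<integral>\<^sup>+x. f x \<partial>lborel)))" for A :: "real ^ 'n ^ 'n"
  have mult: "P (A ** B)" if A: "P A" and B: "P B" for A B :: "real ^ 'n ^ 'n"
    unfolding P_def
  proof safe
    fix f :: "real ^ 'n \<Rightarrow> ennreal"
    assume d: "det (A ** B) \<noteq> 0" and f [measurable]: "f \<in> borel_measurable borel"
    have fA: "(\<lambda>x. f (A *v x)) \<in> borel_measurable borel"
      by measurable
    have "ennreal \<bar>det (A ** B)\<bar> * (\<integral>\<^sup>+x. f ((A ** B) *v x) \<partial>lborel) =
       ennreal \<bar>det A\<bar> * (ennreal \<bar>det B\<bar> * (\<integral>\<^sup>+x. f (A *v (B *v x)) \<partial>lborel))"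
      by (simp add: det_mul abs_mult ennreal_mult mult.assoc matrix_vector_mul_assoc)
    also have "ennreal \<bar>det B\<bar> * (\<integral>\<^sup>+x. f (A *v (B *v x)) \<partial>lborel) = (\<integral>\<^sup>+x. f (A *v x) \<partial>lborel)"
      using bspec[OF _ fA] B d by (auto simp: P_def det_mul)
    also have "ennreal \<bar>det A\<bar> * \<dots> = (\<integral>\<^sup>+x. f x \<partial>lborel)"
      using bspec[OF _ f] A d by (auto simp: P_def det_mul)
    finally show "ennreal \<bar>det (A ** B)\<bar> * (\<integral>\<^sup>+x. f ((A ** B) *v x) \<partial>lborel) = (\<integral>\<^sup>+x. f x \<partial>lborel)" .
  qed
  have diagonal: "P D" if D: "\<And>i j. i \<noteq> j \<Longrightarrow> D $ i $ j = 0" for D :: "real ^ 'n ^ 'n"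
    unfolding P_def
  proof safe
    fix f :: "real ^ 'n \<Rightarrow> ennreal"
    assume d: "det D \<noteq> 0" and [measurable]: "f \<in> borel_measurable borel"
    define c where "c = (\<lambda>b :: real ^ 'n. (D *v b) \<bullet> b)"
    have detD: "det D = (\<Prod>i\<in>UNIV. D $ i $ i)"
      by (rule det_diagonal) (use D in auto)
    have cD: "c (axis i 1) = D $ i $ i" for i
      by (simp add: c_def inner_axis matrix_vector_mul_component column_def matrix_vector_mult_basis)
    have c0: "c b \<noteq> 0" if "b \<in> Basis" for b
      using that d detD cD by (auto simp: Basis_vec_def)
    have Dx: "0 + (\<Sum>b\<in>Basis. (c b * (x \<bullet> b)) *\<^sub>R b) = D *v x" for x
    proof -
      have "(D *v x) \<bullet> b = c b * (x \<bullet> b)" if bB: "b \<in> Basis" for b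
      proof -
        obtain i where b: "b = axis i 1" using bB by (auto simp: Basis_vec_def)
        have "(D *v x) $ i = D $ i $ i * x $ i"
          using D by (simp add: matrix_vector_mult_def) (subst sum.remove[of _ i], auto intro!: sum.neutral)
        then show ?thesis by (simp add: b cD inner_axis)
      qed
      then show ?thesis
        using euclidean_representation[of "D *v x"] by simp
    qed
    have "lborel = density (distr lborel borel (\<lambda>x. D *v x)) (\<lambda>_. \<Prod>b\<in>Basis. \<bar>c b\<bar>)"
      using lborel_affine_euclidean[of c 0] c0 unfolding Dx by simp
    moreover have "(\<Prod>b\<in>Basis. \<bar>c b\<bar>) = \<bar>det D\<bar>"
      unfolding detD abs_prod using prod_Basis_vec[of "\<lambda>_ b. \<bar>c b\<bar>" 0] by (simp add: cD)
    ultimately have l: "lborel = density (distr lborel borel (\<lambda>x. D *v x)) (\<lambda>_. ennreal \<bar>det D\<bar>)"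
      by simp
    show "ennreal \<bar>det D\<bar> * (\<integral>\<^sup>+x. f (D *v x) \<partial>lborel) = (\<integral>\<^sup>+x. f x \<partial>lborel)"
      by (subst (2) l) (simp add: nn_integral_density nn_integral_distr nn_integral_cmult)
  qed
  have shear: "P (shear_matrix m n c)" if "m \<noteq> n" for m n c
    using that by (simp add: P_def det_shear_matrix shear_matrix_mult nn_integral_shear)
  have swap: "P (\<chi> i j. mat 1 $ i $ Transposition.transpose m n j)" (is "P ?T") if mn: "m \<noteq> n" for m n :: 'n
  proof -
    let ?D = "\<chi> i j. if i = j then if i = n then -1 else 1 else 0 :: real ^ 'n ^ 'n"
    have Dx: "?D *v x = (\<chi> i. if i = n then - x $ i else x $ i)" for x
      by (simp add: vec_eq_iff matrix_vector_mult_def if_distrib[of "\<lambda>a. a * _"] cong: if_cong)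
    have Tx: "(?T *v x) $ i = x $ Transposition.transpose m n i" for x i
    proof -
      have "mat 1 $ i $ Transposition.transpose m n j * x $ j =
          (if j = Transposition.transpose m n i then x $ j else 0)" for j
        by (auto simp: mat_def)
      then show ?thesis by (simp add: matrix_vector_mult_def)
    qed
    \<comment> \<open>\<open>(a, b) \<mapsto> (a + b, b) \<mapsto> (a + b, - a) \<mapsto> (b, - a) \<mapsto> (b, a)\<close>\<close>
    have "(?T *v x) $ i =
        ((?D ** (shear_matrix m n 1 ** (shear_matrix n m (-1) ** shear_matrix m n 1))) *v x) $ i" for x i
      unfolding Tx matrix_vector_mul_assoc[symmetric] Dx shear_matrix_mult[OF mn]
        shear_matrix_mult[OF mn[symmetric]]
      using mn by (simp add: axis_def Transposition.transpose_def)
    then have "?T = ?D ** (shear_matrix m n 1 ** (shear_matrix n m (-1) ** shear_matrix m n 1))"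
      unfolding matrix_eq vec_eq_iff[of "_ *v _"] by blast
    moreover have "P ?D"
      by (rule diagonal) simp
    ultimately show ?thesis
      using mn by (simp only:) (intro mult shear, auto)
  qed
  have "P A"
  proof (rule induct_matrix_elementary[where P = P])
    show "P A" if "row i A = 0" for A i
      using det_zero_row(2)[OF that] by (simp add: P_def)
    show "P (\<chi> i j. if i = m \<and> j = n then c else of_bool (i = j))" if "m \<noteq> n" for m n c
      using shear[OF that] by (simp add: shear_matrix_def)
  qed (use mult diagonal swap in blast)+
  then show ?thesis using assms by (simp add: P_def)
qed

text \<open>Gram-Schmidt for the inner product x'Sy; the orthonormal vectors become the columns of
  \<open>V\<close>.\<close>

lemma sym_pos_def_congruent_identity:
  fixes S :: "real ^ 'n ^ 'n"
  assumes "sym_pos_def S"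
  obtains V :: "real ^ 'n ^ 'n" where "transpose V ** S ** V = mat 1"
proof -
  have sym: "x \<bullet> (S *v y) = y \<bullet> (S *v x)" for x y
    using assms unfolding sym_pos_def_def by (metis inner_commute inner_transpose_mult)
  have pos: "x \<bullet> (S *v x) > 0" if "x \<noteq> 0" for x
    using assms that by (simp add: sym_pos_def_def)
  have "\<exists>v. \<forall>i\<in>J. \<forall>j\<in>J. v i \<bullet> (S *v v j) = of_bool (i = j)" for J :: "'n set"
    using finite[of J]
  proof (induction J rule: finite_induct)
    case empty
    then show ?case by simp
  next
    case (insert k J)
    then obtain v where v: "\<And>i j. i \<in> J \<Longrightarrow> j \<in> J \<Longrightarrow> v i \<bullet> (S *v v j) = of_bool (i = j)"
      by blast
    have "dim (span (v ` J)) \<le> card (v ` J)"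
      by (simp add: dim_le_card')
    also have "\<dots> \<le> card J" by (rule card_image_le) simp
    also have "\<dots> < CARD('n)"
      using insert.hyps by (intro psubset_card_mono) auto
    finally have "span (v ` J) \<noteq> UNIV"
      by (metis dim_UNIV DIM_cart DIM_real mult_1_right nat_neq_iff)
    then obtain x where x: "x \<notin> span (v ` J)" by auto
    \<comment> \<open>The residue of x after projection, orthogonal in the sense of
      \<open>S\<close>, onto the vectors already chosen; it is nonzero because x is outside their
      span.\<close>
    define y where "y = x - (\<Sum>j\<in>J. (v j \<bullet> (S *v x)) *\<^sub>R v j)"
    have "y \<noteq> 0"
    proof
      assume "y = 0"
      then have "x = (\<Sum>j\<in>J. (v j \<bullet> (S *v x)) *\<^sub>R v j)" by (simp add: y_def)
      also have "\<dots> \<in> span (v ` J)"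
        by (intro span_sum span_scale span_base) auto
      finally show False using x by simp
    qed
    then have q: "y \<bullet> (S *v y) > 0" by (rule pos)
    have orth: "v i \<bullet> (S *v y) = 0" if "i \<in> J" for i
    proof -
      have "v i \<bullet> (S *v y) = v i \<bullet> (S *v x) - (\<Sum>j\<in>J. (v j \<bullet> (S *v x)) * (v i \<bullet> (S *v v j)))"
        unfolding y_def
        by (simp add: matrix_vector_mult_diff_distrib linear_sum[OF matrix_vector_mul_linear]
            matrix_vector_mult_scaleR inner_diff_right inner_sum_right)
      also have "(\<Sum>j\<in>J. (v j \<bullet> (S *v x)) * (v i \<bullet> (S *v v j))) =
          (\<Sum>j\<in>J. if j = i then v j \<bullet> (S *v x) else 0)"
        using v that by (intro sum.cong) auto
      finally show ?thesis using that by simp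
    qed
    define u where "u = (1 / sqrt (y \<bullet> (S *v y))) *\<^sub>R y"
    have uu: "u \<bullet> (S *v u) = 1"
      using q by (simp add: u_def matrix_vector_mult_scaleR)
    have vu: "v i \<bullet> (S *v u) = 0" "u \<bullet> (S *v v i) = 0" if "i \<in> J" for i
      using orth[OF that] sym[of u "v i"] by (auto simp: u_def matrix_vector_mult_scaleR)
    show ?case
      using insert.hyps v uu vu
      by (intro exI[of _ "v(k := u)"]) auto
  qed
  from this[of UNIV] obtain v :: "'n \<Rightarrow> real ^ 'n"
    where v: "\<And>i j. v i \<bullet> (S *v v j) = of_bool (i = j)" by auto
  define V where "V = (\<chi> i j. v j $ i)"
  have "(transpose V ** S ** V) $ i $ j = v i \<bullet> (S *v v j)" for i j
    by (simp add: V_def transpose_def matrix_matrix_mult_def matrix_vector_mult_def inner_vec_def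
        sum_distrib_left sum_distrib_right mult_ac) (rule sum.swap)
  then have "transpose V ** S ** V = mat 1"
    by (simp add: vec_eq_iff v mat_def)
  then show thesis by (rule that)
qed

lemma matrix_inv_eqI:
  fixes A B :: "real ^ 'n ^ 'n"
  assumes "A ** B = mat 1" "B ** A = mat 1"
  shows "matrix_inv A = B"
  unfolding matrix_inv_def
proof (rule some_equality)
  show "C = B" if "A ** C = mat 1 \<and> C ** A = mat 1" for C
    using that assms(2) by (metis matrix_mul_assoc matrix_mul_lid matrix_mul_rid)
qed (use assms in simp)

section \<open>Gaussian measures with covariance \<open>S\<close>\<close>

context
  fixes S :: "real ^ 'n ^ 'n"
  assumes S: "sym_pos_def S"
begin

text \<open>With V'SV = 1, the map U = V' whitens the law. The inverse of \<open>S\<close> is U'U,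
  so the exponent becomes |U x|^2, and (det S)^(-1/2) is |det U|, the Jacobian of x to U x. The
  inverse R = S V of \<open>U\<close> is therefore a square root with R R' = S.\<close>

lemma gaussian_measure_eq_image_normal:
  obtains R :: "real ^ 'n ^ 'n" where "R ** transpose R = S"
    "density lborel (gaussian_density S) = distr (density lborel (normal_vec_density 1)) borel (\<lambda>z. R *v z)"
proof -
  obtain V :: "real ^ 'n ^ 'n" where V: "transpose V ** S ** V = mat 1"
    by (rule sym_pos_def_congruent_identity[OF S])
  define U where "U = transpose V"
  have VU: "transpose U = V" by (simp add: U_def)
  have inv1: "U ** (S ** V) = mat 1" using V by (simp add: U_def matrix_mul_assoc)
  then have inv2: "(S ** V) ** U = mat 1" by (simp add: matrix_left_right_inverse)
  define R where "R = S ** V"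
  have UR: "U ** R = mat 1" and RU: "R ** U = mat 1" using inv1 inv2 by (simp_all add: R_def)
  have symS: "transpose S = S" using S by (simp add: sym_pos_def_def)
  have "R ** transpose R = S ** V ** (U ** S)"
    by (simp add: R_def matrix_transpose_mul symS U_def)
  also have "\<dots> = ((S ** V) ** U) ** S" by (simp add: matrix_mul_assoc)
  finally have RR: "R ** transpose R = S" by (simp add: inv2)
  have "S ** (V ** U) = mat 1" using inv2 by (simp add: matrix_mul_assoc)
  moreover from this have "(V ** U) ** S = mat 1" by (simp add: matrix_left_right_inverse)
  ultimately have Sinv: "matrix_inv S = V ** U"
    by (rule matrix_inv_eqI)
  have quad: "x \<bullet> (matrix_inv S *v x) = (norm (U *v x))\<^sup>2" for x
    unfolding Sinv matrix_vector_mul_assoc[symmetric] power2_norm_eq_inner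
    by (metis VU inner_transpose_mult inner_commute)
  have "det U * det U * det S = det (transpose V ** S ** V)"
    by (simp add: det_mul U_def)
  then have detS: "det U * det U * det S = 1" unfolding V by simp
  then have detU: "det U \<noteq> 0" by auto
  have "det S powr (- 1 / 2) = \<bar>det U\<bar>"
  proof -
    have "det S = 1 / (det U)\<^sup>2" using detS detU by (simp add: field_simps power2_eq_square)
    then have "sqrt (det S) = 1 / \<bar>det U\<bar>" and "0 < det S" using detU by (simp_all add: real_sqrt_divide)
    then show ?thesis
      using detU by (simp add: powr_minus_divide powr_half_sqrt)
  qed
  then have dens: "gaussian_density S x = \<bar>det U\<bar> * normal_vec_density 1 (U *v x)" for x
    by (simp add: gaussian_density_def normal_vec_density_1 quad)
  have [measurable]: "gaussian_density S \<in> borel_measurable borel"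
    unfolding dens[abs_def] by measurable
  have "density lborel (gaussian_density S) = distr (density lborel (normal_vec_density 1)) borel (\<lambda>z. R *v z)"
  proof (rule measure_eqI)
    fix X assume "X \<in> sets (density lborel (gaussian_density S))"
    then have [measurable]: "X \<in> sets borel" by simp
    have "emeasure (distr (density lborel (normal_vec_density 1)) borel (\<lambda>z. R *v z)) X =
        (\<integral>\<^sup>+y. indicator X y \<partial>distr (density lborel (normal_vec_density 1)) borel (\<lambda>z. R *v z))"
      by simp
    also have "\<dots> = (\<integral>\<^sup>+z. indicator X (R *v z) \<partial>density lborel (normal_vec_density 1))"
      by (subst nn_integral_distr) auto
    also have "\<dots> = (\<integral>\<^sup>+z. ennreal (normal_vec_density 1 z) * indicator X (R *v z) \<partial>lborel)"
      by (subst nn_integral_density) auto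
    \<comment> \<open>The substitution z = U x undoes \<open>R\<close> inside the indicator and
      produces the determinant factor of the density.\<close>
    also have "\<dots> = ennreal \<bar>det U\<bar> *
        (\<integral>\<^sup>+x. ennreal (normal_vec_density 1 (U *v x)) * indicator X (R *v (U *v x)) \<partial>lborel)"
      by (rule nn_integral_linear_substitution[OF detU, symmetric]) measurable
    also have "\<dots> = (\<integral>\<^sup>+x. ennreal (gaussian_density S x) * indicator X x \<partial>lborel)"
      by (subst nn_integral_cmult[symmetric])
        (auto simp: dens ennreal_mult mult.assoc matrix_vector_mul_assoc RU)
    also have "\<dots> = emeasure (density lborel (gaussian_density S)) X"
      by (simp add: emeasure_density)
    finally show "emeasure (density lborel (gaussian_density S)) X =
        emeasure (distr (density lborel (normal_vec_density 1)) borel (\<lambda>z. R *v z)) X" by simp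
  qed simp
  with RR that show thesis by blast
qed

lemma gaussian_density_nonneg: "0 \<le> gaussian_density S x"
  by (simp add: gaussian_density_def)

lemma measurable_gaussian_density [measurable]: "gaussian_density S \<in> borel_measurable borel"
  unfolding gaussian_density_def[abs_def] by measurable

lemma prob_space_gaussian: "prob_space (density lborel (gaussian_density S))"
proof -
  obtain R :: "real ^ 'n ^ 'n" where "density lborel (gaussian_density S) =
      distr (density lborel (normal_vec_density 1)) borel (\<lambda>z. R *v z)"
    by (rule gaussian_measure_eq_image_normal)
  then show ?thesis
    by (simp add: prob_space.prob_space_distr[OF prob_space_normal_vec])
qed

lemma charfun_gaussian:
  "charfun (density lborel (gaussian_density S)) \<theta> = exp (- (\<theta> \<bullet> (S *v \<theta>)) / 2)"
proof -
  obtain R :: "real ^ 'n ^ 'n" where R: "R ** transpose R = S"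
    "density lborel (gaussian_density S) =
      distr (density lborel (normal_vec_density 1)) borel (\<lambda>z. R *v z)"
    by (rule gaussian_measure_eq_image_normal)
  have "charfun (density lborel (gaussian_density S)) \<theta> =
      (CLINT z|density lborel (normal_vec_density 1). iexp (\<theta> \<bullet> (R *v z)))"
    unfolding R(2) charfun_def by (subst integral_distr) auto
  also have "\<dots> = charfun (density lborel (normal_vec_density 1)) (transpose R *v \<theta>)"
    unfolding charfun_def inner_transpose_mult ..
  also have "\<dots> = exp (- (norm (transpose R *v \<theta>))\<^sup>2 / 2)"
    using charfun_normal_vec_measure[of 1 "transpose R *v \<theta>"] by simp
  also have "(norm (transpose R *v \<theta>))\<^sup>2 = \<theta> \<bullet> (S *v \<theta>)"
    unfolding power2_norm_eq_inner inner_transpose_mult matrix_vector_mul_assoc R(1) ..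
  finally show ?thesis .
qed

text \<open>The projection of the Gaussian law on \<theta> has the characteristic function of sqrt q
  times a standard normal variable, so Levy uniqueness identifies the two laws. Scaling a standard
  normal variable also covers q = 0, where there is no density.\<close>

lemma gaussian_second_moment:
  "has_bochner_integral (density lborel (gaussian_density S)) (\<lambda>x. (\<theta> \<bullet> x)\<^sup>2) (\<theta> \<bullet> (S *v \<theta>))"
proof -
  let ?\<mu> = "density lborel (gaussian_density S)"
  interpret prob_space ?\<mu> by (rule prob_space_gaussian)
  define q where "q = \<theta> \<bullet> (S *v \<theta>)"
  have q: "0 \<le> q"
    using S unfolding q_def sym_pos_def_def by (cases "\<theta> = 0") (auto simp: less_imp_le)
  interpret N: prob_space std_normal_distribution
    by (rule prob_space_normal_density) simp
  have "char (distr ?\<mu> borel (\<lambda>x. \<theta> \<bullet> x)) t = char (distr std_normal_distribution borel (\<lambda>z. sqrt q * z)) t" for t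
  proof -
    have "char (distr ?\<mu> borel (\<lambda>x. \<theta> \<bullet> x)) t = charfun ?\<mu> (t *\<^sub>R \<theta>)"
      unfolding char_def charfun_def by (subst integral_distr) auto
    also have "\<dots> = exp (- (t\<^sup>2 * q) / 2)"
      unfolding charfun_gaussian q_def by (simp add: matrix_vector_mult_scaleR power2_eq_square mult.assoc)
    also have "\<dots> = char std_normal_distribution (sqrt q * t)"
      using q by (simp add: char_std_normal_distribution power_mult_distrib mult.commute)
    also have "\<dots> = char (distr std_normal_distribution borel (\<lambda>z. sqrt q * z)) t"
      unfolding char_def by (subst integral_distr) (auto simp: mult_ac)
    finally show ?thesis .
  qed
  then have eq: "distr ?\<mu> borel (\<lambda>x. \<theta> \<bullet> x) = distr std_normal_distribution borel (\<lambda>z. sqrt q * z)"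
    by (intro Levy_uniqueness real_distribution_distr N.real_distribution_distr) auto
  have "has_bochner_integral lborel (\<lambda>z. std_normal_density z * z\<^sup>2) 1"
    using std_normal_moment_even[of 1] by (simp add: eval_nat_numeral)
  then have "has_bochner_integral std_normal_distribution (\<lambda>z. z\<^sup>2) 1"
    by (intro has_bochner_integral_density) auto
  then have "has_bochner_integral std_normal_distribution (\<lambda>z. q * z\<^sup>2) q"
    using has_bochner_integral_mult_right[of q std_normal_distribution "\<lambda>z. z\<^sup>2" 1] by simp
  then have "has_bochner_integral (distr std_normal_distribution borel (\<lambda>z. sqrt q * z)) (\<lambda>y. y\<^sup>2) q"
    using q by (intro has_bochner_integral_distr) (auto simp: power_mult_distrib)
  then have "has_bochner_integral ?\<mu> (\<lambda>x. (\<theta> \<bullet> x)\<^sup>2) q"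
    unfolding eq[symmetric] has_bochner_integral_iff
    by (simp add: integrable_distr_eq integral_distr)
  then show ?thesis by (simp add: q_def)
qed

text \<open>The integrand is the sum of the squared projections on the rows of \<open>K\<close>. The
  second moments come with integrability, so the integral is not the default value 0 of a divergent
  one.\<close>

lemma J_power_gaussian_feedback:
  "J_power (gaussian_density S) (feedback_law K) = trace (K ** S ** transpose K)"
proof -
  have "feedback_law K x \<bullet> feedback_law K x = (\<Sum>i\<in>UNIV. (row i K \<bullet> x)\<^sup>2)" for x
    by (simp add: feedback_law_def inner_vec_def[of "K *v x"] matrix_vector_mul_component row_def
        power2_eq_square)
  moreover have "has_bochner_integral (density lborel (gaussian_density S))
      (\<lambda>x. \<Sum>i\<in>UNIV. (row i K \<bullet> x)\<^sup>2) (trace (K ** S ** transpose K))"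
    unfolding trace_gram by (intro has_bochner_integral_sum gaussian_second_moment)
  ultimately show ?thesis
    by (simp add: J_power_def has_bochner_integral_integral_eq)
qed

end

subsection \<open>Linear stochastic differential equations\<close>

context
  fixes M :: "'a measure" and w :: "real \<Rightarrow> 'a \<Rightarrow> real ^ 'p"
  assumes W: "wiener_process M w"
begin

lemma wiener_prob_space: "prob_space M"
  using W by (simp add: wiener_process_def)

lemma measurable_wiener: "0 \<le> t \<Longrightarrow> w t \<in> borel_measurable M"
  using W by (simp add: wiener_process_def)

lemma wiener_increment_char:
  assumes "0 \<le> s" "s \<le> t"
  shows "(CLINT \<omega>|M. iexp (a \<bullet> (w t \<omega> - w s \<omega>))) = exp (- ((norm a)\<^sup>2 * (t - s)) / 2)"
proof (cases "s = t")
  \<comment> \<open>\<open>wiener_process\<close> provides a density only for s < t; for s = t the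
    increment is 0.\<close>
  case True
  interpret prob_space M by (rule wiener_prob_space)
  show ?thesis using True by (simp add: prob_space)
next
  case False
  then have st: "0 < t - s" using assms by simp
  have D: "distributed M lborel (\<lambda>\<omega>. w t \<omega> - w s \<omega>) (normal_vec_density (sqrt (t - s)))"
    using W assms False by (simp add: wiener_process_def normal_vec_density_def)
  have [measurable]: "(\<lambda>\<omega>. w t \<omega> - w s \<omega>) \<in> borel_measurable M"
    using assms by (intro borel_measurable_diff measurable_wiener) auto
  have "(CLINT \<omega>|M. iexp (a \<bullet> (w t \<omega> - w s \<omega>))) =
      (CLINT z|distr M lborel (\<lambda>\<omega>. w t \<omega> - w s \<omega>). iexp (a \<bullet> z))"
    by (subst integral_distr) auto
  also have "\<dots> = charfun (density lborel (normal_vec_density (sqrt (t - s)))) a"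
    by (simp only: distributed_distr_eq_density[OF D] charfun_def)
  also have "\<dots> = exp (- ((norm a)\<^sup>2 * (t - s)) / 2)"
    using charfun_normal_vec_measure[of "sqrt (t - s)" a] st by (simp add: algebra_simps)
  finally show ?thesis .
qed

text \<open>Independence factors the expectation into those of single increments. The sum has the
  shape that the noise part of the Euler scheme takes when paired with a functional.\<close>

lemma wiener_increments_char:
  assumes \<tau>: "0 \<le> \<tau> 0" "incseq \<tau>"
  shows "(CLINT \<omega>|M. iexp (\<Sum>k<N. a k \<bullet> (w (\<tau> (Suc k)) \<omega> - w (\<tau> k) \<omega>))) =
    exp (- (\<Sum>k<N. (norm (a k))\<^sup>2 * (\<tau> (Suc k) - \<tau> k)) / 2)"
proof -
  interpret prob_space M by (rule wiener_prob_space)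
  have \<tau>0: "0 \<le> \<tau> k" for k using \<tau> incseqD[OF \<tau>(2), of 0 k] by simp
  have [measurable]: "w (\<tau> k) \<in> borel_measurable M" for k
    by (rule measurable_wiener[OF \<tau>0])
  let ?X = "\<lambda>k \<omega>. a k \<bullet> (w (\<tau> (Suc k)) \<omega> - w (\<tau> k) \<omega>)"
  have "indep_vars (\<lambda>_. borel) (\<lambda>k \<omega>. w (\<tau> (Suc k)) \<omega> - w (\<tau> k) \<omega>) {..<N}"
    using W \<tau> by (simp add: wiener_process_def)
  then have "indep_vars (\<lambda>_. borel) ?X {..<N}"
    by (rule indep_vars_compose2[where Y = "\<lambda>k. (\<bullet>) (a k)"]) measurable
  then have "char (distr M borel (\<lambda>\<omega>. \<Sum>k<N. ?X k \<omega>)) 1 = (\<Prod>k<N. char (distr M borel (?X k)) 1)"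
    by (rule char_distr_sum)
  moreover have "char (distr M borel Z) 1 = (CLINT \<omega>|M. iexp (Z \<omega>))"
    if [measurable]: "Z \<in> borel_measurable M" for Z
    unfolding char_def by (subst integral_distr) auto
  ultimately have "(CLINT \<omega>|M. iexp (\<Sum>k<N. ?X k \<omega>)) = (\<Prod>k<N. CLINT \<omega>|M. iexp (?X k \<omega>))"
    by simp
  also have "\<dots> = (\<Prod>k<N. complex_of_real (exp (- ((norm (a k))\<^sup>2 * (\<tau> (Suc k) - \<tau> k)) / 2)))"
    by (intro prod.cong refl wiener_increment_char \<tau>0 incseq_SucD \<tau>)
  also have "\<dots> = complex_of_real (exp (\<Sum>k<N. - ((norm (a k))\<^sup>2 * (\<tau> (Suc k) - \<tau> k)) / 2))"
    by (simp add: exp_sum)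
  also have "(\<Sum>k<N. - ((norm (a k))\<^sup>2 * (\<tau> (Suc k) - \<tau> k)) / 2) =
      - (\<Sum>k<N. (norm (a k))\<^sup>2 * (\<tau> (Suc k) - \<tau> k)) / 2"
    by (simp add: sum_negf sum_divide_distrib)
  finally show ?thesis .
qed

text \<open>Setting \<open>w\<close> to 0 on an exceptional null set allows the integral equation to
  be solved for every \<omega>, not just almost every one.\<close>

lemma wiener_continuous_version:
  obtains v where "\<And>t. 0 \<le> t \<Longrightarrow> v t \<in> borel_measurable M" "\<And>\<omega>. v 0 \<omega> = 0"
    "\<And>\<omega>. continuous_on {0..} (\<lambda>t. v t \<omega>)" "AE \<omega> in M. \<forall>t. v t \<omega> = w t \<omega>"
proof -
  have "AE \<omega> in M. w 0 \<omega> = 0 \<and> continuous_on {0..} (\<lambda>t. w t \<omega>)"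
    using W by (simp add: wiener_process_def)
  then obtain N where N: "{\<omega> \<in> space M. \<not> (w 0 \<omega> = 0 \<and> continuous_on {0..} (\<lambda>t. w t \<omega>))} \<subseteq> N"
    "emeasure M N = 0" "N \<in> sets M"
    by (rule AE_E)
  define v where "v = (\<lambda>t \<omega>. if \<omega> \<in> space M - N then w t \<omega> else 0)"
  show thesis
  proof (rule that[of v])
    show "v t \<in> borel_measurable M" if "0 \<le> t" for t
      unfolding v_def using N(3) measurable_wiener[OF that] by measurable
    show "v 0 \<omega> = 0" "continuous_on {0..} (\<lambda>t. v t \<omega>)" for \<omega>
      using N(1) by (cases "\<omega> \<in> space M - N"; force simp: v_def)+
    show "AE \<omega> in M. \<forall>t. v t \<omega> = w t \<omega>"
      using AE_not_in[of N M] N AE_space by (auto simp: v_def null_sets_def)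
  qed
qed

section \<open>Solutions, their flow and the characterisation of invariance\<close>

context
  fixes F :: "real ^ 'n ^ 'n" and G :: "real ^ 'p ^ 'n"
begin

definition euler_maruyama :: "real \<Rightarrow> nat \<Rightarrow> real ^ 'n \<Rightarrow> 'a \<Rightarrow> real ^ 'n" where
  "euler_maruyama t n \<xi> \<omega> = euler F (t / real n) \<xi>
     (\<lambda>k. G *v (w (real (Suc k) * (t / real n)) \<omega> - w (real k * (t / real n)) \<omega>)) n"

text \<open>\<open>euler_converges\<close> is applied to each path with g = G w. One null set serves
  all t, because it only excludes paths that violate the equation, continuity or
  \<open>w 0 \<omega> = 0\<close>.\<close>

lemma sde_solution_eq_euler_limit:
  assumes "linear_sde_solution M w F G \<xi> x"
  shows "AE \<omega> in M. \<forall>t\<ge>0. (\<lambda>n. euler_maruyama t n \<xi> \<omega>) \<longlonglongrightarrow> x t \<omega>"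
proof -
  have "AE \<omega> in M. w 0 \<omega> = 0"
    using W by (simp add: wiener_process_def)
  moreover have "AE \<omega> in M. continuous_on {0..} (\<lambda>t. x t \<omega>) \<and>
      (\<forall>t\<ge>0. x t \<omega> = \<xi> + integral {0..t} (\<lambda>s. F *v x s \<omega>) + G *v w t \<omega>)"
    using assms by (simp add: linear_sde_solution_def)
  ultimately show ?thesis
  proof eventually_elim
    case (elim \<omega>)
    show ?case
    proof (intro allI impI)
      fix t :: real assume t: "0 \<le> t"
      have "continuous_on {0..t} (\<lambda>t. x t \<omega>)"
        using elim by (auto intro: continuous_on_subset)
      then show "(\<lambda>n. euler_maruyama t n \<xi> \<omega>) \<longlonglongrightarrow> x t \<omega>"
        using euler_converges[OF t, of "\<lambda>t. x t \<omega>" \<xi> F "\<lambda>t. G *v w t \<omega>"] elim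
        by (simp add: euler_maruyama_def matrix_vector_mult_diff_distrib)
    qed
  qed
qed

text \<open>Both solutions are limits of the same scheme, which is a function of \<xi> and
  \<open>w\<close> alone.\<close>

lemma sde_solution_unique:
  assumes "linear_sde_solution M w F G \<xi> x" "linear_sde_solution M w F G \<xi> y"
  shows "AE \<omega> in M. \<forall>t\<ge>0. x t \<omega> = y t \<omega>"
  using assms[THEN sde_solution_eq_euler_limit]
  by eventually_elim (blast intro: LIMSEQ_unique)

lemma measurable_euler:
  assumes "X \<in> borel_measurable N" "\<And>k. d k \<in> borel_measurable N"
  shows "(\<lambda>p. euler F h (X p) (\<lambda>k. d k p) n) \<in> borel_measurable N"
proof (induction n)
  case 0
  show ?case using assms by simp
next
  case (Suc n)
  note [measurable] = Suc assms
  show ?case by simp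
qed

text \<open>The integral equation is solved separately for every \<xi> and \<omega>. Joint
  measurability, needed to integrate over a random initial state, follows because the solution is a
  pointwise limit of Euler schemes, each jointly measurable.\<close>

lemma sde_flow_exists:
  obtains X where "\<And>\<xi>. linear_sde_solution M w F G \<xi> (\<lambda>t \<omega>. X t (\<xi>, \<omega>))"
    "\<And>t. 0 \<le> t \<Longrightarrow> X t \<in> borel_measurable (borel \<Otimes>\<^sub>M M)"
proof -
  obtain v where v: "\<And>t. 0 \<le> t \<Longrightarrow> v t \<in> borel_measurable M" "\<And>\<omega>. v 0 \<omega> = 0"
    "\<And>\<omega>. continuous_on {0..} (\<lambda>t. v t \<omega>)" "AE \<omega> in M. \<forall>t. v t \<omega> = w t \<omega>"
    by (rule wiener_continuous_version) blast
  have "\<exists>x. continuous_on {0..} x \<and>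
      (\<forall>t\<ge>0. x t = integral {0..t} (\<lambda>s. F *v x s) + (\<xi> + G *v v t \<omega>))" for \<xi> \<omega>
    by (intro linear_integral_equation_solvable continuous_on_add continuous_on_const
        continuous_on_matrix_mult v)
  then obtain x where x: "\<And>\<xi> \<omega>. continuous_on {0..} (x \<xi> \<omega>)"
    "\<And>\<xi> \<omega> t. 0 \<le> t \<Longrightarrow> x \<xi> \<omega> t = integral {0..t} (\<lambda>s. F *v x \<xi> \<omega> s) + (\<xi> + G *v v t \<omega>)"
    by metis
  define X where "X = (\<lambda>t (\<xi>, \<omega>). x \<xi> \<omega> t)"
  have X: "X t \<in> borel_measurable (borel \<Otimes>\<^sub>M M)" if t: "0 \<le> t" for t
  proof (rule borel_measurable_LIMSEQ_metric)
    let ?d = "\<lambda>n k p. G *v v (real (Suc k) * (t / real n)) (snd p) - G *v v (real k * (t / real n)) (snd p)"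
    show "(\<lambda>p. euler F (t / real n) (fst p) (\<lambda>k. ?d n k p) n) \<in> borel_measurable (borel \<Otimes>\<^sub>M M)" for n
    proof (rule measurable_euler)
      fix k
      have [measurable]: "v (real (Suc k) * (t / real n)) \<in> borel_measurable M"
        "v (real k * (t / real n)) \<in> borel_measurable M"
        using t by (auto intro!: v(1))
      show "?d n k \<in> borel_measurable (borel \<Otimes>\<^sub>M M)" by measurable
    qed measurable
    show "(\<lambda>n. euler F (t / real n) (fst p) (\<lambda>k. ?d n k p) n) \<longlonglongrightarrow> X t p" for p
    proof -
      obtain \<xi> \<omega> where p: "p = (\<xi>, \<omega>)" by (cases p)
      have "continuous_on {0..t} (x \<xi> \<omega>)" by (rule continuous_on_subset[OF x(1)]) auto
      then show ?thesis
        using euler_converges[OF t, of "x \<xi> \<omega>" \<xi> F "\<lambda>t. G *v v t \<omega>"] x(2) v(2)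
        by (simp add: p X_def add_ac)
    qed
  qed
  have "linear_sde_solution M w F G \<xi> (\<lambda>t \<omega>. X t (\<xi>, \<omega>))" for \<xi>
    unfolding linear_sde_solution_def
  proof safe
    show "(\<lambda>\<omega>. X t (\<xi>, \<omega>)) \<in> borel_measurable M" if "0 \<le> t" for t
      by (rule measurable_compose[OF _ X[OF that]]) simp
    show "AE \<omega> in M. continuous_on {0..} (\<lambda>t. X t (\<xi>, \<omega>)) \<and>
      (\<forall>t\<ge>0. X t (\<xi>, \<omega>) = \<xi> + integral {0..t} (\<lambda>s. F *v X s (\<xi>, \<omega>)) + G *v w t \<omega>)"
      using v(4)
    proof eventually_elim
      case (elim \<omega>)
      show ?case
        unfolding X_def prod.case
      proof (intro conjI allI impI x(1))
        fix t :: real assume "0 \<le> t"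
        from x(2)[OF this, of \<xi> \<omega>] elim
        show "x \<xi> \<omega> t = \<xi> + integral {0..t} (\<lambda>s. F *v x \<xi> \<omega> s) + G *v w t \<omega>"
          by (simp add: add_ac)
      qed
    qed
  qed
  with X that show thesis by blast
qed

text \<open>By \<open>inner_euler\<close> the paired scheme is a constant plus a linear combination
  of independent Wiener increments, so its characteristic function is explicit.\<close>

lemma euler_maruyama_char:
  fixes \<theta> :: "real ^ 'n"
  assumes t: "0 \<le> t"
  defines "e \<equiv> \<lambda>n. euler (transpose F) (t / real n) \<theta> (\<lambda>_. 0)"
  shows "(CLINT \<omega>|M. iexp (\<theta> \<bullet> euler_maruyama t n \<xi> \<omega>)) =
    iexp (e n n \<bullet> \<xi>) * exp (- (t / real n * (\<Sum>j<n. (norm (transpose G *v e n j))\<^sup>2)) / 2)"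
proof -
  let ?h = "t / real n"
  let ?\<tau> = "\<lambda>k. real k * ?h"
  let ?a = "\<lambda>k. transpose G *v e n (n - 1 - k)"
  have h: "0 \<le> ?h" using t by simp
  have \<tau>: "0 \<le> ?\<tau> 0" "incseq ?\<tau>" by (simp, intro incseq_SucI mult_right_mono) (use h in auto)
  have "(CLINT \<omega>|M. iexp (\<theta> \<bullet> euler_maruyama t n \<xi> \<omega>)) =
      (CLINT \<omega>|M. iexp (e n n \<bullet> \<xi>) * iexp (\<Sum>k<n. ?a k \<bullet> (w (?\<tau> (Suc k)) \<omega> - w (?\<tau> k) \<omega>)))"
    unfolding euler_maruyama_def inner_euler e_def inner_transpose_mult
    by (simp only: of_real_add distrib_left exp_add)
  also have "\<dots> = iexp (e n n \<bullet> \<xi>) * exp (- (\<Sum>k<n. (norm (?a k))\<^sup>2 * (?\<tau> (Suc k) - ?\<tau> k)) / 2)"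
    unfolding integral_mult_right_zero wiener_increments_char[OF \<tau>] ..
  also have "(\<Sum>k<n. (norm (?a k))\<^sup>2 * (?\<tau> (Suc k) - ?\<tau> k)) = ?h * (\<Sum>k<n. (norm (?a k))\<^sup>2)"
    unfolding sum_distrib_left by (intro sum.cong refl) (simp add: algebra_simps add_divide_distrib)
  \<comment> \<open>Propagation is backwards in time: the increment of step k meets the adjoint
    iterate n - 1 - k. Reversing the order of summation removes this.\<close>
  also have "(\<Sum>k<n. (norm (?a k))\<^sup>2) = (\<Sum>j<n. (norm (transpose G *v e n j))\<^sup>2)"
    using sum.nat_diff_reindex[of "\<lambda>j. (norm (transpose G *v e n j))\<^sup>2" n] by simp
  finally show ?thesis .
qed

text \<open>Dominated convergence is used in \<omega> for fixed \<xi>, then in \<xi>. The noise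
  factor does not depend on \<xi>, so averaging over the initial law only turns the remaining factor
  into \<open>charfun \<mu>\<close>.\<close>

lemma charfun_flow_limit:
  fixes \<mu> :: "(real ^ 'n) measure" and \<theta> :: "real ^ 'n"
  assumes \<mu>: "prob_space \<mu>" "sets \<mu> = sets borel"
    and X: "\<And>\<xi>. linear_sde_solution M w F G \<xi> (\<lambda>t \<omega>. X t (\<xi>, \<omega>))"
      "X t \<in> borel_measurable (borel \<Otimes>\<^sub>M M)"
    and t: "0 \<le> t"
  defines "e \<equiv> \<lambda>n. euler (transpose F) (t / real n) \<theta> (\<lambda>_. 0)"
  shows "(\<lambda>n. charfun \<mu> (e n n) * exp (- (t / real n * (\<Sum>j<n. (norm (transpose G *v e n j))\<^sup>2)) / 2))
    \<longlonglongrightarrow> charfun (distr (\<mu> \<Otimes>\<^sub>M M) borel (X t)) \<theta>"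
proof -
  interpret M: prob_space M by (rule wiener_prob_space)
  interpret \<mu>: prob_space \<mu> by (rule \<mu>)
  interpret pair_prob_space \<mu> M ..
  note \<mu>(2)[measurable_cong]
  have [measurable]: "X t \<in> borel_measurable (borel \<Otimes>\<^sub>M M)" by (rule X(2))
  define c where "c = (\<lambda>n. complex_of_real (exp (- (t / real n * (\<Sum>j<n. (norm (transpose G *v e n j))\<^sup>2)) / 2)))"
  have norm_c: "norm (c n) \<le> 1" for n
    using t by (simp add: c_def sum_nonneg)
  have inner: "(\<lambda>n. iexp (e n n \<bullet> \<xi>) * c n) \<longlonglongrightarrow> (CLINT \<omega>|M. iexp (\<theta> \<bullet> X t (\<xi>, \<omega>)))" for \<xi>
  proof -
    have [measurable]: "euler_maruyama t n \<xi> \<in> borel_measurable M" for n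
    proof -
      have [measurable]: "w (real k * (t / real n)) \<in> borel_measurable M" for k
        using t by (intro measurable_wiener) auto
      show ?thesis unfolding euler_maruyama_def by (rule measurable_euler) measurable
    qed
    have "(\<lambda>n. CLINT \<omega>|M. iexp (\<theta> \<bullet> euler_maruyama t n \<xi> \<omega>)) \<longlonglongrightarrow> (CLINT \<omega>|M. iexp (\<theta> \<bullet> X t (\<xi>, \<omega>)))"
    proof (rule integral_dominated_convergence[where w = "\<lambda>_. 1"])
      show "AE \<omega> in M. (\<lambda>n. iexp (\<theta> \<bullet> euler_maruyama t n \<xi> \<omega>)) \<longlonglongrightarrow> iexp (\<theta> \<bullet> X t (\<xi>, \<omega>))"
        using sde_solution_eq_euler_limit[OF X(1)[of \<xi>]]
        by eventually_elim (use t in \<open>auto intro!: tendsto_intros\<close>)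
    qed auto
    then show ?thesis
      unfolding euler_maruyama_char[OF t] e_def c_def .
  qed
  have "(\<lambda>n. CLINT \<xi>|\<mu>. iexp (e n n \<bullet> \<xi>) * c n) \<longlonglongrightarrow> (CLINT \<xi>|\<mu>. CLINT \<omega>|M. iexp (\<theta> \<bullet> X t (\<xi>, \<omega>)))"
  proof (rule integral_dominated_convergence[where w = "\<lambda>_. 1"])
    show "(\<lambda>\<xi>. CLINT \<omega>|M. iexp (\<theta> \<bullet> X t (\<xi>, \<omega>))) \<in> borel_measurable \<mu>"
      by measurable
  qed (use inner norm_c in \<open>auto simp: norm_mult\<close>)
  moreover have "(CLINT \<xi>|\<mu>. iexp (e n n \<bullet> \<xi>) * c n) = charfun \<mu> (e n n) * c n" for n
    by (simp add: charfun_def)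
  moreover have "charfun (distr (\<mu> \<Otimes>\<^sub>M M) borel (X t)) \<theta> = (CLINT \<xi>|\<mu>. CLINT \<omega>|M. iexp (\<theta> \<bullet> X t (\<xi>, \<omega>)))"
  proof -
    have "integrable (\<mu> \<Otimes>\<^sub>M M) (\<lambda>p. iexp (\<theta> \<bullet> X t p))"
      by (rule integrable_const_bound[of _ 1]) auto
    from integral_fst'[OF this] show ?thesis
      unfolding charfun_def by (subst integral_distr) auto
  qed
  ultimately show ?thesis
    unfolding c_def by simp
qed

text \<open>Tonelli links the averaged transition kernels in \<open>invariant_density\<close> with
  the law of the flow under an independent initial state.\<close>

lemma emeasure_flow_image:
  fixes \<mu> :: "(real ^ 'n) measure"
  assumes \<mu>: "prob_space \<mu>" "sets \<mu> = sets borel"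
    and X: "X t \<in> borel_measurable (borel \<Otimes>\<^sub>M M)" and E: "E \<in> sets borel"
  shows "emeasure (distr (\<mu> \<Otimes>\<^sub>M M) borel (X t)) E =
    (\<integral>\<^sup>+\<xi>. emeasure (distr M borel (\<lambda>\<omega>. X t (\<xi>, \<omega>))) E \<partial>\<mu>)"
proof -
  interpret M: prob_space M by (rule wiener_prob_space)
  note \<mu>(2)[measurable_cong] X[measurable] E[measurable]
  have "emeasure (distr (\<mu> \<Otimes>\<^sub>M M) borel (X t)) E =
      (\<integral>\<^sup>+\<xi>. emeasure M (Pair \<xi> -` (X t -` E \<inter> space (\<mu> \<Otimes>\<^sub>M M))) \<partial>\<mu>)"
    by (simp add: emeasure_distr M.emeasure_pair_measure_alt)
  also have "\<dots> = (\<integral>\<^sup>+\<xi>. emeasure (distr M borel (\<lambda>\<omega>. X t (\<xi>, \<omega>))) E \<partial>\<mu>)"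
  proof (rule nn_integral_cong)
    fix \<xi> assume "\<xi> \<in> space \<mu>"
    then have "Pair \<xi> -` (X t -` E \<inter> space (\<mu> \<Otimes>\<^sub>M M)) = (\<lambda>\<omega>. X t (\<xi>, \<omega>)) -` E \<inter> space M"
      by (auto simp: space_pair_measure)
    then show "emeasure M (Pair \<xi> -` (X t -` E \<inter> space (\<mu> \<Otimes>\<^sub>M M))) =
        emeasure (distr M borel (\<lambda>\<omega>. X t (\<xi>, \<omega>))) E"
      by (simp add: emeasure_distr)
  qed
  finally show ?thesis .
qed

text \<open>Invariance means that the flow started from \<mu> has law \<mu> at every time. By
  \<open>charfun_unique\<close> this can be tested on characteristic functions, and that of the flow
  is the limit in \<open>charfun_flow_limit\<close>.\<close>

lemma invariant_density_iff_charfun: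
  fixes \<rho> :: "real ^ 'n \<Rightarrow> real"
  defines "\<mu> \<equiv> density lborel \<rho>"
  assumes \<rho>: "\<rho> \<in> borel_measurable borel" "\<And>x. 0 \<le> \<rho> x" "prob_space \<mu>"
  shows "invariant_density M w F G \<rho> \<longleftrightarrow>
    (\<forall>t\<ge>0. \<forall>\<theta>. (\<lambda>n. charfun \<mu> (euler (transpose F) (t / real n) \<theta> (\<lambda>_. 0) n) *
      exp (- (t / real n * (\<Sum>j<n. (norm (transpose G *v euler (transpose F) (t / real n) \<theta> (\<lambda>_. 0) j))\<^sup>2)) / 2))
      \<longlonglongrightarrow> charfun \<mu> \<theta>)" (is "_ \<longleftrightarrow> ?R")
proof -
  interpret M: prob_space M by (rule wiener_prob_space)
  have sets: "sets \<mu> = sets borel" by (simp add: \<mu>_def)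
  obtain X where X: "\<And>\<xi>. linear_sde_solution M w F G \<xi> (\<lambda>t \<omega>. X t (\<xi>, \<omega>))"
    "\<And>t. 0 \<le> t \<Longrightarrow> X t \<in> borel_measurable (borel \<Otimes>\<^sub>M M)"
    by (rule sde_flow_exists) blast
  note limit = charfun_flow_limit[where X = X, OF \<rho>(3) sets X(1) X(2)]
  have image: "emeasure (distr (\<mu> \<Otimes>\<^sub>M M) borel (X t)) E =
      (\<integral>\<^sup>+\<xi>. emeasure (distr M borel (\<lambda>\<omega>. X t (\<xi>, \<omega>))) E \<partial>\<mu>)"
    if "0 \<le> t" "E \<in> sets borel" for t E
    by (rule emeasure_flow_image[where X = X, OF \<rho>(3) sets X(2)[OF that(1)] that(2)])
  show ?thesis
  proof
    assume "invariant_density M w F G \<rho>"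
    then obtain Y where Y: "\<And>\<xi>. linear_sde_solution M w F G \<xi> (Y \<xi>)"
      "\<And>t E. 0 \<le> t \<Longrightarrow> E \<in> sets borel \<Longrightarrow>
        (\<integral>\<^sup>+\<xi>. emeasure (distr M borel (Y \<xi> t)) E \<partial>\<mu>) = emeasure \<mu> E"
      unfolding invariant_density_def \<mu>_def by blast
    have D: "distr (\<mu> \<Otimes>\<^sub>M M) borel (X t) = \<mu>" if t: "0 \<le> t" for t
    proof (rule measure_eqI)
      fix E assume "E \<in> sets (distr (\<mu> \<Otimes>\<^sub>M M) borel (X t))"
      then have E: "E \<in> sets borel" by simp
      \<comment> \<open>The family \<open>Y\<close> is not assumed jointly measurable in \<xi> and
        \<omega>; pathwise uniqueness replaces its kernels by those of the flow
        \<open>X\<close>.\<close>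
      have "distr M borel (\<lambda>\<omega>. X t (\<xi>, \<omega>)) = distr M borel (Y \<xi> t)" for \<xi>
      proof (rule distr_cong_AE)
        show "AE \<omega> in M. X t (\<xi>, \<omega>) = Y \<xi> t \<omega>"
          using sde_solution_unique[OF X(1)[of \<xi>] Y(1)[of \<xi>]] by eventually_elim (use t in blast)
        show "(\<lambda>\<omega>. X t (\<xi>, \<omega>)) \<in> borel_measurable M" "Y \<xi> t \<in> borel_measurable M"
          using X(1)[of \<xi>] Y(1)[of \<xi>] t by (auto simp: linear_sde_solution_def)
      qed auto
      then show "emeasure (distr (\<mu> \<Otimes>\<^sub>M M) borel (X t)) E = emeasure \<mu> E"
        using image[OF t E] Y(2)[OF t E] by simp
    qed (simp add: sets)
    show ?R
    proof (intro allI impI)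
      fix t :: real and \<theta> assume t: "0 \<le> t"
      show "(\<lambda>n. charfun \<mu> (euler (transpose F) (t / real n) \<theta> (\<lambda>_. 0) n) *
        exp (- (t / real n * (\<Sum>j<n. (norm (transpose G *v euler (transpose F) (t / real n) \<theta> (\<lambda>_. 0) j))\<^sup>2)) / 2))
        \<longlonglongrightarrow> charfun \<mu> \<theta>"
        using limit[OF t t, of \<theta>] unfolding D[OF t] .
    qed
  next
    assume R: ?R
    have "distr (\<mu> \<Otimes>\<^sub>M M) borel (X t) = \<mu>" if t: "0 \<le> t" for t
    proof (rule charfun_unique)
      interpret \<mu>: prob_space \<mu> by (rule \<rho>)
      interpret pair_prob_space \<mu> M ..
      have "X t \<in> borel_measurable (\<mu> \<Otimes>\<^sub>M M)"
        unfolding measurable_cong_sets[OF sets_pair_measure_cong[OF sets refl] refl]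
        by (rule X(2)[OF t])
      then show "prob_space (distr (\<mu> \<Otimes>\<^sub>M M) borel (X t))"
        by (rule prob_space_distr)
      show "charfun (distr (\<mu> \<Otimes>\<^sub>M M) borel (X t)) \<theta> = charfun \<mu> \<theta>" for \<theta>
        by (rule LIMSEQ_unique[OF limit[OF t t] R[rule_format, OF t]])
    qed (use \<rho> sets in auto)
    then have "(\<integral>\<^sup>+\<xi>. emeasure (distr M borel (\<lambda>\<omega>. X t (\<xi>, \<omega>))) E \<partial>\<mu>) = emeasure \<mu> E"
      if "0 \<le> t" "E \<in> sets borel" for t E
      using image[OF that] that by simp
    then show "invariant_density M w F G \<rho>"
      unfolding invariant_density_def
      using \<rho> X(1) by (auto simp: \<mu>_def intro!: exI[of _ "\<lambda>\<xi> t \<omega>. X t (\<xi>, \<omega>)"])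
  qed
qed

end

end

subsection \<open>The Lyapunov equation\<close>

lemma quadratic_form_bounds:
  fixes H :: "real ^ 'n ^ 'n"
  obtains C where "0 \<le> C" "\<And>x. \<bar>x \<bullet> (H *v x)\<bar> \<le> C * (norm x)\<^sup>2"
    "\<And>x y. \<bar>x \<bullet> (H *v x) - y \<bullet> (H *v y)\<bar> \<le> C * norm (x - y) * (norm x + norm y)"
proof -
  obtain C where C: "0 < C" "\<And>x. norm (H *v x) \<le> C * norm x"
    by (rule norm_matrix_bound[of H]) blast
  have b: "\<bar>x \<bullet> (H *v y)\<bar> \<le> C * (norm x * norm y)" for x y
  proof -
    have "\<bar>x \<bullet> (H *v y)\<bar> \<le> norm x * norm (H *v y)" by (rule Cauchy_Schwarz_ineq2)
    also have "\<dots> \<le> norm x * (C * norm y)" by (intro mult_left_mono C) simp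
    finally show ?thesis by (simp add: mult_ac)
  qed
  show thesis
  proof (rule that[of C])
    show "\<bar>x \<bullet> (H *v x)\<bar> \<le> C * (norm x)\<^sup>2" for x
      using b[of x x] by (simp add: power2_eq_square)
    fix x y :: "real ^ 'n"
    have "x \<bullet> (H *v x) - y \<bullet> (H *v y) = x \<bullet> (H *v (x - y)) + (x - y) \<bullet> (H *v y)"
      by (simp add: matrix_vector_mult_diff_distrib inner_diff_left inner_diff_right)
    then have "\<bar>x \<bullet> (H *v x) - y \<bullet> (H *v y)\<bar> \<le> \<bar>x \<bullet> (H *v (x - y))\<bar> + \<bar>(x - y) \<bullet> (H *v y)\<bar>"
      by simp
    also have "\<dots> \<le> C * (norm x * norm (x - y)) + C * (norm (x - y) * norm y)"
      by (intro add_mono b)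
    finally show "\<bar>x \<bullet> (H *v x) - y \<bullet> (H *v y)\<bar> \<le> C * norm (x - y) * (norm x + norm y)"
      by (simp add: algebra_simps)
  qed (use C in simp)
qed

context
  fixes F S :: "real ^ 'n ^ 'n" and \<theta> :: "real ^ 'n"
begin

text \<open>The n summands are bounded uniformly by \<open>D\<close>, so the factor (t / n)^2 leaves
  at most t^2 D / n.\<close>

lemma euler_second_order_term_tendsto_0:
  assumes t: "0 \<le> t"
  shows "(\<lambda>n. (t / real n)\<^sup>2 * (\<Sum>j<n. (F *v euler F (t / real n) \<theta> (\<lambda>_. 0) j) \<bullet>
    (S *v (F *v euler F (t / real n) \<theta> (\<lambda>_. 0) j)))) \<longlonglongrightarrow> 0"
proof -
  obtain c where c: "0 < c" "\<And>x. norm (F *v x) \<le> c * norm x"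
    by (rule norm_matrix_bound[of F]) blast
  obtain C where C: "0 \<le> C" "\<And>x. \<bar>x \<bullet> (S *v x)\<bar> \<le> C * (norm x)\<^sup>2"
    by (rule quadratic_form_bounds[of S]) blast
  define D where "D = C * (c * (exp (t * c) * norm \<theta>))\<^sup>2"
  define r where "r = (\<lambda>n. (t / real n)\<^sup>2 * (\<Sum>j<n. (F *v euler F (t / real n) \<theta> (\<lambda>_. 0) j) \<bullet>
    (S *v (F *v euler F (t / real n) \<theta> (\<lambda>_. 0) j))))"
  have bound: "norm (r n) \<le> t\<^sup>2 * D * (1 / real n)" if n: "0 < n" for n
  proof -
    let ?e = "euler F (t / real n) \<theta> (\<lambda>_. 0)"
    have "\<bar>(F *v ?e j) \<bullet> (S *v (F *v ?e j))\<bar> \<le> D" if j: "j < n" for j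
    proof -
      have "norm (?e j) \<le> exp (real j * (t / real n) * c) * norm \<theta>"
        by (rule norm_euler_zero_le) (use c t in auto)
      also have "\<dots> \<le> exp (t * c) * norm \<theta>"
      proof -
        have "real j * (t / real n) \<le> real n * (t / real n)"
          using j t by (intro mult_right_mono) auto
        then have "real j * (t / real n) * c \<le> t * c"
          using n c(1) by (intro mult_right_mono) auto
        then show ?thesis by (intro mult_right_mono) auto
      qed
      finally have "norm (F *v ?e j) \<le> c * (exp (t * c) * norm \<theta>)"
        using c by (intro order_trans[OF c(2)] mult_left_mono) auto
      then have "C * (norm (F *v ?e j))\<^sup>2 \<le> D"
        unfolding D_def using C(1) by (intro mult_left_mono power_mono) auto
      then show ?thesis using C(2)[of "F *v ?e j"] by simp
    qed
    then have "(\<Sum>j<n. \<bar>(F *v ?e j) \<bullet> (S *v (F *v ?e j))\<bar>) \<le> real (card {..<n}) * D"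
      by (intro sum_bounded_above) auto
    then have "\<bar>\<Sum>j<n. (F *v ?e j) \<bullet> (S *v (F *v ?e j))\<bar> \<le> real n * D"
      using order_trans[OF sum_abs] by simp
    then have "norm (r n) \<le> (t / real n)\<^sup>2 * (real n * D)"
      unfolding r_def real_norm_def abs_mult by (simp add: mult_left_mono)
    also have "\<dots> = t\<^sup>2 * D * (1 / real n)"
      using n by (simp add: power2_eq_square)
    finally show ?thesis .
  qed
  have "r \<longlonglongrightarrow> 0"
  proof (rule Lim_null_comparison)
    show "\<forall>\<^sub>F n in sequentially. norm (r n) \<le> t\<^sup>2 * D * (1 / real n)"
      using bound by (auto intro: eventually_sequentiallyI[of 1])
    show "(\<lambda>n. t\<^sup>2 * D * (1 / real n)) \<longlonglongrightarrow> 0"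
      using tendsto_mult_right_zero[OF lim_1_over_n] by blast
  qed
  then show ?thesis unfolding r_def .
qed

text \<open>All iterates stay within O(t) of \<theta>, uniformly in n, so each summand differs from
  the form at \<theta> by O(t); the total weight t makes this O(t^2). The restriction t \<le> 1 lets
  the constant be independent of t.\<close>

lemma euler_quadratic_sum_bound:
  obtains C where "\<And>t n. 0 \<le> t \<Longrightarrow> t \<le> 1 \<Longrightarrow> 0 < n \<Longrightarrow>
    \<bar>t / real n * (\<Sum>j<n. euler F (t / real n) \<theta> (\<lambda>_. 0) j \<bullet> (H *v euler F (t / real n) \<theta> (\<lambda>_. 0) j))
      - t * (\<theta> \<bullet> (H *v \<theta>))\<bar> \<le> C * t\<^sup>2"
proof -
  obtain c where c: "0 < c" "\<And>x. norm (F *v x) \<le> c * norm x"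
    by (rule norm_matrix_bound[of F]) blast
  obtain C where C: "0 \<le> C"
    "\<And>x y. \<bar>x \<bullet> (H *v x) - y \<bullet> (H *v y)\<bar> \<le> C * norm (x - y) * (norm x + norm y)"
    by (rule quadratic_form_bounds[of H]) blast
  define N where "N = exp c * norm \<theta>"
  have "\<bar>t / real n * (\<Sum>j<n. euler F (t / real n) \<theta> (\<lambda>_. 0) j \<bullet> (H *v euler F (t / real n) \<theta> (\<lambda>_. 0) j))
      - t * (\<theta> \<bullet> (H *v \<theta>))\<bar> \<le> (C * (c * N) * (N + norm \<theta>)) * t\<^sup>2"
    if t: "0 \<le> t" "t \<le> 1" and n: "0 < n" for t n
  proof -
    let ?e = "euler F (t / real n) \<theta> (\<lambda>_. 0)"
    let ?q = "\<lambda>x. x \<bullet> (H *v x)"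
    have e: "\<bar>?q (?e j) - ?q \<theta>\<bar> \<le> C * (t * (c * N)) * (N + norm \<theta>)" if j: "j < n" for j
    proof -
      have "real j * (t / real n) \<le> real n * (t / real n)"
        using j t by (intro mult_right_mono) auto
      then have jt: "real j * (t / real n) \<le> t" using n by simp
      have tc: "exp (t * c) \<le> exp c" using t c by (simp add: mult_left_le_one_le)
      have "norm (?e j) \<le> exp (real j * (t / real n) * c) * norm \<theta>"
        by (rule norm_euler_zero_le) (use c t in auto)
      also have "\<dots> \<le> exp (t * c) * norm \<theta>"
        using mult_right_mono[OF jt, of c] c(1) by (intro mult_right_mono) auto
      also have "\<dots> \<le> N" unfolding N_def by (intro mult_right_mono tc) simp
      finally have e1: "norm (?e j) \<le> N" .
      have "norm (?e j - \<theta>) \<le> real j * (t / real n) * c * exp (real n * (t / real n) * c) * norm \<theta>"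
        by (rule norm_euler_zero_diff_le) (use c t j in auto)
      also have "\<dots> = real j * (t / real n) * (c * (exp (t * c) * norm \<theta>))"
        using n by simp
      also have "\<dots> \<le> t * (c * N)"
        unfolding N_def using jt tc c t by (intro mult_mono mult_left_mono mult_right_mono) auto
      finally have e2: "norm (?e j - \<theta>) \<le> t * (c * N)" .
      have "\<bar>?q (?e j) - ?q \<theta>\<bar> \<le> C * norm (?e j - \<theta>) * (norm (?e j) + norm \<theta>)"
        by (rule C(2))
      also have "\<dots> \<le> C * (t * (c * N)) * (N + norm \<theta>)"
        using e1 e2 C(1) c t by (intro mult_mono mult_left_mono add_mono) (auto simp: N_def)
      finally show ?thesis .
    qed
    have "t / real n * (\<Sum>j<n. ?q (?e j)) - t * ?q \<theta> = t / real n * (\<Sum>j<n. ?q (?e j) - ?q \<theta>)"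
      using n by (simp add: sum_subtractf right_diff_distrib)
    then have "\<bar>t / real n * (\<Sum>j<n. ?q (?e j)) - t * ?q \<theta>\<bar> = t / real n * \<bar>\<Sum>j<n. ?q (?e j) - ?q \<theta>\<bar>"
      using t by (simp add: abs_mult)
    also have "\<dots> \<le> t / real n * (real n * (C * (t * (c * N)) * (N + norm \<theta>)))"
    proof (intro mult_left_mono)
      have "\<bar>\<Sum>j<n. ?q (?e j) - ?q \<theta>\<bar> \<le> (\<Sum>j<n. \<bar>?q (?e j) - ?q \<theta>\<bar>)"
        by (rule sum_abs)
      also have "\<dots> \<le> real (card {..<n}) * (C * (t * (c * N)) * (N + norm \<theta>))"
        by (rule sum_bounded_above) (use e in auto)
      finally show "\<bar>\<Sum>j<n. ?q (?e j) - ?q \<theta>\<bar> \<le> real n * (C * (t * (c * N)) * (N + norm \<theta>))"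
        by simp
    qed (use t in simp)
    also have "\<dots> = (C * (c * N) * (N + norm \<theta>)) * t\<^sup>2"
      using n by (simp add: power2_eq_square)
    finally show ?thesis .
  qed
  then show thesis by (rule that)
qed

end

lemma invariant_gaussian_iff_lyapunov:
  fixes F S :: "real ^ 'n ^ 'n" and G :: "real ^ 'p ^ 'n"
  assumes W: "wiener_process M w" and S: "sym_pos_def S"
  shows "invariant_density M w F G (gaussian_density S) \<longleftrightarrow>
    F ** S + S ** transpose F + G ** transpose G = 0"
proof -
  define H where "H = F ** S + S ** transpose F + G ** transpose G"
  have symS: "transpose S = S" using S by (simp add: sym_pos_def_def)
  define e where "e = (\<lambda>t n \<theta>. euler (transpose F) (t / real n) \<theta> (\<lambda>_. 0))"
  define L where "L = (\<lambda>t n \<theta>. t / real n * (\<Sum>j<n. e t n \<theta> j \<bullet> (H *v e t n \<theta> j)))"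
  define r where "r = (\<lambda>t n \<theta>. (t / real n)\<^sup>2 *
    (\<Sum>j<n. (transpose F *v e t n \<theta> j) \<bullet> (S *v (transpose F *v e t n \<theta> j))))"
  have r: "(\<lambda>n. r t n \<theta>) \<longlonglongrightarrow> 0" if "0 \<le> t" for t \<theta>
    unfolding r_def e_def by (rule euler_second_order_term_tendsto_0[OF that])
  \<comment> \<open>The exponents of the initial law and of the noise add up to the left side of
    \<open>euler_quadratic_telescope\<close> with h = t / n.\<close>
  have exponent: "charfun (density lborel (gaussian_density S)) (e t n \<theta> n) *
      exp (- (t / real n * (\<Sum>j<n. (norm (transpose G *v e t n \<theta> j))\<^sup>2)) / 2) =
      exp (- (\<theta> \<bullet> (S *v \<theta>) + L t n \<theta> + r t n \<theta>) / 2)" for t n \<theta>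
  proof -
    have "charfun (density lborel (gaussian_density S)) (e t n \<theta> n) *
      exp (- (t / real n * (\<Sum>j<n. (norm (transpose G *v e t n \<theta> j))\<^sup>2)) / 2) =
      exp (- (e t n \<theta> n \<bullet> (S *v e t n \<theta> n) + t / real n * (\<Sum>j<n. (norm (transpose G *v e t n \<theta> j))\<^sup>2)) / 2)"
      by (simp only: charfun_gaussian[OF S] of_real_mult[symmetric] exp_add[symmetric]
          minus_add_distrib add_divide_distrib)
    also have "e t n \<theta> n \<bullet> (S *v e t n \<theta> n) + t / real n * (\<Sum>j<n. (norm (transpose G *v e t n \<theta> j))\<^sup>2)
        = \<theta> \<bullet> (S *v \<theta>) + L t n \<theta> + r t n \<theta>"
      unfolding L_def r_def e_def H_def by (rule euler_quadratic_telescope[OF symS])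
    finally show ?thesis .
  qed
  have "invariant_density M w F G (gaussian_density S) \<longleftrightarrow>
      (\<forall>t\<ge>0. \<forall>\<theta>. (\<lambda>n. complex_of_real (exp (- (\<theta> \<bullet> (S *v \<theta>) + L t n \<theta> + r t n \<theta>) / 2)))
        \<longlonglongrightarrow> complex_of_real (exp (- (\<theta> \<bullet> (S *v \<theta>)) / 2)))"
    unfolding invariant_density_iff_charfun[OF W measurable_gaussian_density[OF S]
        gaussian_density_nonneg[OF S] prob_space_gaussian[OF S]]
    unfolding exponent[unfolded e_def] unfolding charfun_gaussian[OF S] ..
  \<comment> \<open>These are exponentials of real numbers, so convergence can be tested on the
    exponents, where the remainder \<open>r\<close> vanishes.\<close>
  also have "\<dots> \<longleftrightarrow> (\<forall>t\<ge>0. \<forall>\<theta>. (\<lambda>n. L t n \<theta>) \<longlonglongrightarrow> 0)"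
  proof (intro all_cong all_cong1)
    fix t :: real and \<theta> assume t: "0 \<le> t"
    let ?V = "\<theta> \<bullet> (S *v \<theta>)"
    have "(\<lambda>n. exp (- (?V + L t n \<theta> + r t n \<theta>) / 2)) \<longlonglongrightarrow> exp (- ?V / 2) \<longleftrightarrow> (\<lambda>n. L t n \<theta>) \<longlonglongrightarrow> 0"
    proof
      assume "(\<lambda>n. exp (- (?V + L t n \<theta> + r t n \<theta>) / 2)) \<longlonglongrightarrow> exp (- ?V / 2)"
      then have "(\<lambda>n. ln (exp (- (?V + L t n \<theta> + r t n \<theta>) / 2))) \<longlonglongrightarrow> ln (exp (- ?V / 2))"
        by (rule tendsto_ln) simp
      then have "(\<lambda>n. - (?V + L t n \<theta> + r t n \<theta>) / 2) \<longlonglongrightarrow> - ?V / 2"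
        by (simp only: ln_exp)
      then have "(\<lambda>n. (- 2) * (- (?V + L t n \<theta> + r t n \<theta>) / 2) - ?V - r t n \<theta>) \<longlonglongrightarrow> (- 2) * (- ?V / 2) - ?V - 0"
        by (intro tendsto_diff tendsto_mult tendsto_const r[OF t])
      moreover have "(- 2) * (- (?V + L t n \<theta> + r t n \<theta>) / 2) - ?V - r t n \<theta> = L t n \<theta>" for n
        by (simp add: field_simps)
      ultimately show "(\<lambda>n. L t n \<theta>) \<longlonglongrightarrow> 0" by (simp only:) simp
    next
      assume "(\<lambda>n. L t n \<theta>) \<longlonglongrightarrow> 0"
      then have "(\<lambda>n. exp (- (?V + L t n \<theta> + r t n \<theta>) / 2)) \<longlonglongrightarrow> exp (- (?V + 0 + 0) / 2)"
        by (intro tendsto_exp tendsto_divide tendsto_minus tendsto_add tendsto_const r[OF t]) auto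
      then show "(\<lambda>n. exp (- (?V + L t n \<theta> + r t n \<theta>) / 2)) \<longlonglongrightarrow> exp (- ?V / 2)" by simp
    qed
    then show "(\<lambda>n. complex_of_real (exp (- (?V + L t n \<theta> + r t n \<theta>) / 2)))
        \<longlonglongrightarrow> complex_of_real (exp (- ?V / 2)) \<longleftrightarrow> (\<lambda>n. L t n \<theta>) \<longlonglongrightarrow> 0"
      by (simp only: tendsto_of_real_iff)
  qed
  also have "\<dots> \<longleftrightarrow> H = 0"
  proof
    assume L0: "\<forall>t\<ge>0. \<forall>\<theta>. (\<lambda>n. L t n \<theta>) \<longlonglongrightarrow> 0"
    have "\<theta> \<bullet> (H *v \<theta>) = 0" for \<theta>
    proof (rule ccontr)
      assume nz: "\<theta> \<bullet> (H *v \<theta>) \<noteq> 0"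
      obtain C where C: "\<And>t n. 0 \<le> t \<Longrightarrow> t \<le> 1 \<Longrightarrow> 0 < n \<Longrightarrow>
          \<bar>L t n \<theta> - t * (\<theta> \<bullet> (H *v \<theta>))\<bar> \<le> C * t\<^sup>2"
        unfolding L_def e_def by (rule euler_quadratic_sum_bound[of "transpose F" \<theta> H]) blast
      \<comment> \<open>\<open>L\<close> tends to 0 in n but stays within C t^2 of t
        \<theta>'H\<theta>. The limit in n followed by division by t gives the estimate.\<close>
      have bound: "\<bar>\<theta> \<bullet> (H *v \<theta>)\<bar> \<le> C * t" if t: "0 < t" "t \<le> 1" for t
      proof -
        have "(\<lambda>n. \<bar>L t n \<theta> - t * (\<theta> \<bullet> (H *v \<theta>))\<bar>) \<longlonglongrightarrow> \<bar>0 - t * (\<theta> \<bullet> (H *v \<theta>))\<bar>"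
          using L0 t by (intro tendsto_intros) auto
        then have "\<bar>0 - t * (\<theta> \<bullet> (H *v \<theta>))\<bar> \<le> C * t\<^sup>2"
          by (rule LIMSEQ_le_const2) (use C t in \<open>auto intro!: exI[of _ 1]\<close>)
        then have "t * \<bar>\<theta> \<bullet> (H *v \<theta>)\<bar> \<le> t * (C * t)"
          using t by (simp add: abs_mult power2_eq_square mult_ac)
        then show ?thesis using t by simp
      qed
      have C0: "0 < C" using bound[of 1] nz by simp
      \<comment> \<open>This t makes C t at most half of |\<theta>'H\<theta>|, contradicting
        \<open>bound\<close>; its instance at t = 1 has shown that \<open>C\<close> is
        positive.\<close>
      define t where "t = min 1 (\<bar>\<theta> \<bullet> (H *v \<theta>)\<bar> / (2 * C))"
      have t: "0 < t" "t \<le> 1" using nz C0 by (auto simp: t_def)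
      have "C * t \<le> C * (\<bar>\<theta> \<bullet> (H *v \<theta>)\<bar> / (2 * C))"
        using C0 by (intro mult_left_mono) (auto simp: t_def)
      also have "\<dots> = \<bar>\<theta> \<bullet> (H *v \<theta>)\<bar> / 2" using C0 by simp
      finally show False using bound[OF t] nz by simp
    qed
    moreover have "transpose H = H"
      by (simp add: H_def transpose_add matrix_transpose_mul symS add.commute)
    ultimately show "H = 0" by (intro symmetric_matrix_zero_if_quadratic_zero)
  next
    assume "H = 0"
    then show "\<forall>t\<ge>0. \<forall>\<theta>. (\<lambda>n. L t n \<theta>) \<longlonglongrightarrow> 0" by (simp add: L_def)
  qed
  finally show ?thesis unfolding H_def .
qed

section \<open>Optimality of the feedback law\<close>

theorem proposition2:
  fixes A :: "real ^ 'n ^ 'n" and B :: "real ^ 'm ^ 'n" and B1 :: "real ^ 'p ^ 'n"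
    and S P :: "real ^ 'n ^ 'n"
    and M :: "'a measure" and w :: "real \<Rightarrow> 'a \<Rightarrow> real ^ 'p"
  assumes "wiener_process M w"
    and "controllable A B"
    and "sym_pos_def S"
    and "transpose P = P"
    and "hurwitz (A - B ** transpose B ** P)"
    and "(A - B ** transpose B ** P) ** S + S ** transpose (A - B ** transpose B ** P)
           + B1 ** transpose B1 = 0"
  shows "is_arg_min (J_power (gaussian_density S))
           (\<lambda>u. \<exists>K. u = feedback_law K \<and>
                    invariant_density M w (A - B ** K) B1 (gaussian_density S))
           (\<lambda>x. - (transpose B *v (P *v x)))"
proof -
  note invariant = invariant_gaussian_iff_lyapunov[OF assms(1,3)]
  have u: "(\<lambda>x. - (transpose B *v (P *v x))) = feedback_law (transpose B ** P)"
    by (simp add: feedback_law_def fun_eq_iff matrix_vector_mul_assoc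
        del: transpose_matrix_vector)
  have S: "transpose S = S" "0 \<le> x \<bullet> (S *v x)" for x
    using assms(3) unfolding sym_pos_def_def by (cases "x = 0"; simp add: less_imp_le)+
  show ?thesis
    unfolding is_arg_min_def u
  proof (intro conjI notI)
    \<comment> \<open>Admissibility of the gain B'P is precisely the assumed Lyapunov
      equation.\<close>
    show "\<exists>K. feedback_law (transpose B ** P) = feedback_law K \<and>
        invariant_density M w (A - B ** K) B1 (gaussian_density S)"
      using assms(6) by (intro exI[of _ "transpose B ** P"]) (simp add: invariant matrix_mul_assoc)
  next
    \<comment> \<open>A strictly cheaper admissible law has a gain satisfying a Lyapunov equation
      with the same noise term, so the trace comparison applies to it.\<close>
    assume "\<exists>y. (\<exists>K. y = feedback_law K \<and> invariant_density M w (A - B ** K) B1 (gaussian_density S)) \<and>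
      J_power (gaussian_density S) y < J_power (gaussian_density S) (feedback_law (transpose B ** P))"
    then obtain K where K: "(A - B ** K) ** S + S ** transpose (A - B ** K) + B1 ** transpose B1 = 0"
      "trace (K ** S ** transpose K) < trace (transpose B ** P ** S ** transpose (transpose B ** P))"
      by (auto simp: invariant J_power_gaussian_feedback[OF assms(3)])
    then show False
      using trace_feedback_minimal[OF S assms(4,6) K(1)] by simp
  qed
qed

end
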